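(* Let $\Gamma=(K,I,J,C,D,q,g)$ be a zero-sum repeated game with an informed controller, i.e. satisfying Assumptions 1 and 2 below. Then for every initial distribution $\pi\in\Delta(K\times C\times D)$ with $\pi(E)=1$, the game $\Gamma(\pi)$ has a general uniform value. That is, there exists $v^*(\pi)$ such that for each $\varepsilon>0$ there exist $\alpha>0$ and strategies $\sigma^*$ of player 1 and $\tau^*$ of player 2 such that for all evaluations $\theta$ with $I(\theta)\le\alpha$: - $|v_\theta(\pi)-v^*(\pi)|\le\varepsilon$, - $\gamma_\theta(\pi,\sigma^*,\tau)\ge v^*(\pi)-\varepsilon$ for all strategies $\tau$ of player 2, and - $\gamma_\theta(\pi,\sigma,\tau^* )\le v^*(\pi)+\varepsilon$ for all strategies $\sigma$ of player 1.
   Context: **Model.** $K,I,J,C,D$ are nonempty finite sets (states, actions of players 1 and 2, signals of players 1 and 2); $q:K\times I\times J\to\Delta(K\times C\times D)$ and $g:K\times I\times J\to[0,1]$. **Play of $\Gamma(\pi)$.** $(k_1,c_1,d_1)$ is drawn from $\pi$; player 1 observes $c_1$ and player 2 observes $d_1$. At each stage $t$: - the players simultaneously choose $i_t\in I$ and $j_t\in J$; - player 1 gets the unobserved payoff $g(k_t,i_t,j_t)$ and player 2 gets its opposite; - $(k_{t+1},c_{t+1},d_{t+1})$ is drawn from $q(k_t,i_t,j_t)$, with $c_{t+1}$ told to player 1 and $d_{t+1}$ told to player 2. **Strategies and values.** - Strategies of player 1 are $\sigma_t:(C\times I)^{t-1}\times C\to\Delta(I)$; strategies of player 2 are $\tau_t:(D\times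 J)^{t-1}\times D\to\Delta(J)$. - For an evaluation $\theta\in\Delta(\mathbb N^* )$, $\gamma_\theta(\pi,\sigma,\tau)=\mathbb E_{\pi,\sigma,\tau}\sum_t\theta_tg(k_t,i_t,j_t)$, and $v_\theta(\pi)=\max_\sigma\min_\tau\gamma_\theta=\min_\tau\max_\sigma\gamma_\theta$. - $I(\theta)=\sum_t|\theta_{t+1}-\theta_t|$. **Assumption 1.** There exist maps $\tilde k:C\to K$ and $\tilde d:C\to D$ such that, with $E=\{(k,c,d):\tilde k(c)=k,\ \tilde d(c)=d\}$, we have $q(k,i,j)(E)=1$ for all $(k,i,j)$. **Assumption 2.** The marginal of $q(k,i,j)$ on $K\times D$ does not depend on $j$. *)

theory Defs
  imports "HOL-Probability.Probability"
begin

text \<open>Stages are indexed from 0 (stage n here is stage n+1 of the paper).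
  A state of play after n stages: current state k, player 1's past
  signal/action history, player 2's past signal/action history, and the
  current signals c and d.\<close>

type_synonym ('c,'i) strat1 = "('c \<times> 'i) list \<Rightarrow> 'c \<Rightarrow> 'i pmf"
type_synonym ('d,'j) strat2 = "('d \<times> 'j) list \<Rightarrow> 'd \<Rightarrow> 'j pmf"

fun play_dist ::
  "('k \<Rightarrow> 'i \<Rightarrow> 'j \<Rightarrow> ('k \<times> 'c \<times> 'd) pmf) \<Rightarrow> ('k \<times> 'c \<times> 'd) pmf \<Rightarrow>
   ('c,'i) strat1 \<Rightarrow> ('d,'j) strat2 \<Rightarrow> nat \<Rightarrow>
   ('k \<times> ('c \<times> 'i) list \<times> ('d \<times> 'j) list \<times> 'c \<times> 'd) pmf" where
  "play_dist q \<pi> \<sigma> \<tau> 0 = map_pmf (\<lambda>(k, c, d). (k, [], [], c, d)) \<pi>"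
| "play_dist q \<pi> \<sigma> \<tau> (Suc n) =
     bind_pmf (play_dist q \<pi> \<sigma> \<tau> n) (\<lambda>(k, hc, hd, c, d).
       bind_pmf (\<sigma> hc c) (\<lambda>i. bind_pmf (\<tau> hd d) (\<lambda>j.
         map_pmf (\<lambda>(k', c', d'). (k', hc @ [(c, i)], hd @ [(d, j)], c', d')) (q k i j))))"

definition stage_payoff ::
  "('k \<Rightarrow> 'i \<Rightarrow> 'j \<Rightarrow> ('k \<times> 'c \<times> 'd) pmf) \<Rightarrow> ('k \<Rightarrow> 'i \<Rightarrow> 'j \<Rightarrow> real) \<Rightarrow>
   ('k \<times> 'c \<times> 'd) pmf \<Rightarrow> ('c,'i) strat1 \<Rightarrow> ('d,'j) strat2 \<Rightarrow> nat \<Rightarrow> real" where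
  "stage_payoff q g \<pi> \<sigma> \<tau> n =
     measure_pmf.expectation (play_dist q \<pi> \<sigma> \<tau> n) (\<lambda>(k, hc, hd, c, d).
       measure_pmf.expectation (\<sigma> hc c) (\<lambda>i.
         measure_pmf.expectation (\<tau> hd d) (\<lambda>j. g k i j)))"

definition is_evaluation :: "(nat \<Rightarrow> real) \<Rightarrow> bool" where
  "is_evaluation \<theta> \<longleftrightarrow> (\<forall>t. 0 \<le> \<theta> t) \<and> \<theta> sums 1"

definition total_variation :: "(nat \<Rightarrow> real) \<Rightarrow> real" where
  "total_variation \<theta> = (\<Sum>t. \<bar>\<theta> (Suc t) - \<theta> t\<bar>)"

definition gamma ::
  "('k \<Rightarrow> 'i \<Rightarrow> 'j \<Rightarrow> ('k \<times> 'c \<times> 'd) pmf) \<Rightarrow> ('k \<Rightarrow> 'i \<Rightarrow> 'j \<Rightarrow> real) \<Rightarrow>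
   (nat \<Rightarrow> real) \<Rightarrow> ('k \<times> 'c \<times> 'd) pmf \<Rightarrow> ('c,'i) strat1 \<Rightarrow> ('d,'j) strat2 \<Rightarrow> real" where
  "gamma q g \<theta> \<pi> \<sigma> \<tau> = (\<Sum>t. \<theta> t * stage_payoff q g \<pi> \<sigma> \<tau> t)"

definition val_theta ::
  "('k \<Rightarrow> 'i \<Rightarrow> 'j \<Rightarrow> ('k \<times> 'c \<times> 'd) pmf) \<Rightarrow> ('k \<Rightarrow> 'i \<Rightarrow> 'j \<Rightarrow> real) \<Rightarrow>
   (nat \<Rightarrow> real) \<Rightarrow> ('k \<times> 'c \<times> 'd) pmf \<Rightarrow> real" where
  "val_theta q g \<theta> \<pi> =
     (SUP \<sigma>::('c,'i) strat1. INF \<tau>::('d,'j) strat2. gamma q g \<theta> \<pi> \<sigma> \<tau>)"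

end

theory Submission
  imports Defs "HOL-Complex_Analysis.Great_Picard"
begin

text \<open>Against an informed controller only the law of (signals of player 2, state, action of
  player 1) matters. These laws form a convex set of flows which player 2 cannot influence, and in
  reply to a flow player 2 may as well minimise stage by stage, using his signals only. Hence the
  value of an evaluation \<open>\<theta>\<close> is a supremum over flows of a concave function, and as a function of
  player 2's belief it is 1-Lipschitz.

  As the variation of \<open>\<theta>\<close> tends to 0, a limit point \<open>w\<close> of these values (Arzela-Ascoli) is excessive:
  it does not increase in expectation along any play. Restarting an evaluation \<open>\<eta>\<close> whose value
  is close to \<open>w\<close> at a date drawn from another evaluation \<open>\<theta>\<close> shows that the value of \<open>\<theta>\<close> is at most
  \<open>w\<close> up to a small error. So there is only one limit point, and it is the uniform value \<open>v\<close>.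

  Optimal play is then obtained on blocks of \<open>N\<close> stages, of which any evaluation of small variation
  is nearly a mixture. For player 2, the minimax theorem on each block gives a strategy holding the
  block average below \<open>v + \<epsilon>\<close>. For player 1, minimax against mixtures of blocks (themselves
  evaluations of small variation) gives one flow whose first \<open>L\<close> block averages all exceed \<open>v - \<epsilon>\<close>,
  and compactness lets \<open>L\<close> tend to infinity.\<close>

subsection \<open>Evaluations of finite support\<close>

text \<open>Player 2 is not powerless: his actions may reach player 1 through \<open>c\<close>, so
  the flow that occurs depends in general on both strategies. What survives is that every play
  yields some flow. Hence two one-sided arguments: player 2 gets a bound valid for all flows at
  once, while player 1 restricts himself to strategies reading only the state and the signals of
  player 2, against which the flow is fixed in advance.

  Flows replace strategies because of minimax: beliefs are products of the choices made at
  successive stages, so payoffs are not concave in strategies, whereas the constraints on a flow are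
  linear. Player 1 needs one minimax over many blocks simultaneously, since his play in one block
  decides the beliefs with which later blocks start.

  The values used here come from stagewise minima and evaluations of finite support. They meet
  \<open>val_theta\<close> only at the end, where strategies guaranteeing nearly \<open>v\<close> on
  both sides pin down the sup-inf; an arbitrary \<open>\<theta>\<close> is compared directly with
  block averages, at the price of \<open>N\<close> times its variation.\<close>

definition finite_eval :: "(nat \<Rightarrow> real) \<Rightarrow> nat \<Rightarrow> bool" where
  "finite_eval \<theta> n \<longleftrightarrow> (\<forall>t. 0 \<le> \<theta> t) \<and> (\<forall>t\<ge>n. \<theta> t = 0) \<and> (\<Sum>t<n. \<theta> t) = 1"

definition variation_upto :: "(nat \<Rightarrow> real) \<Rightarrow> nat \<Rightarrow> real" where
  "variation_upto \<theta> n = (\<Sum>t<n. \<bar>\<theta> (Suc t) - \<theta> t\<bar>)"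

lemma variation_upto_nonneg: "0 \<le> variation_upto \<theta> n"
  by (simp add: variation_upto_def sum_nonneg)

text \<open>\<open>\<theta>\<close> vanishes at \<open>n\<close>, so it must descend from
  \<open>\<theta> 0\<close> to 0 within the range of the sum.\<close>

lemma eval_initial_le_variation:
  assumes "finite_eval \<theta> n" shows "\<theta> 0 \<le> variation_upto \<theta> n"
proof -
  have "\<theta> 0 = - (\<Sum>t<n. \<theta> (Suc t) - \<theta> t)"
    using assms by (simp add: sum_lessThan_telescope finite_eval_def)
  also have "\<dots> \<le> variation_upto \<theta> n"
    unfolding variation_upto_def sum_negf[symmetric] by (intro sum_mono) auto
  finally show ?thesis .
qed

text \<open>Summation by parts. The factor 2 collects the initial term
  \<open>\<theta> 0 * \<rho> 0\<close> and the change of weights, each at most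
  \<open>variation_upto \<theta> n * M\<close>.\<close>

lemma eval_shift_one:
  assumes \<theta>: "finite_eval \<theta> n" and \<rho>: "\<And>t. 0 \<le> \<rho> t" "\<And>t. \<rho> t \<le> M"
  shows "(\<Sum>t<n. \<theta> t * \<rho> t) \<le> (\<Sum>t<n. \<theta> t * \<rho> (Suc t)) + 2 * variation_upto \<theta> n * M"
proof -
  have M: "0 \<le> M" using \<rho>(1)[of 0] \<rho>(2)[of 0] by simp
  have "(\<Sum>t<n. \<theta> t * \<rho> t) \<le> (\<Sum>t<Suc n. \<theta> t * \<rho> t)"
    using \<theta> \<rho> by (simp add: finite_eval_def)
  also have "\<dots> = \<theta> 0 * \<rho> 0 + (\<Sum>t<n. \<theta> (Suc t) * \<rho> (Suc t))"
    by (rule sum.lessThan_Suc_shift)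
  also have "\<dots> = \<theta> 0 * \<rho> 0 + (\<Sum>t<n. \<theta> t * \<rho> (Suc t)) + (\<Sum>t<n. (\<theta> (Suc t) - \<theta> t) * \<rho> (Suc t))"
    by (simp add: sum.distrib[symmetric] algebra_simps)
  also have "(\<Sum>t<n. (\<theta> (Suc t) - \<theta> t) * \<rho> (Suc t)) \<le> (\<Sum>t<n. \<bar>\<theta> (Suc t) - \<theta> t\<bar> * M)"
    by (intro sum_mono mult_mono) (auto simp: \<rho>)
  also have "\<dots> = variation_upto \<theta> n * M"
    by (simp add: variation_upto_def sum_distrib_right)
  also have "\<theta> 0 * \<rho> 0 \<le> variation_upto \<theta> n * M"
    using eval_initial_le_variation[OF \<theta>] \<rho> \<theta> by (intro mult_mono) (auto simp: variation_upto_nonneg)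
  finally show ?thesis by (simp add: algebra_simps)
qed

lemma eval_shift:
  assumes \<theta>: "finite_eval \<theta> n" and \<rho>: "\<And>t. 0 \<le> \<rho> t" "\<And>t. \<rho> t \<le> M"
  shows "(\<Sum>t<n. \<theta> t * \<rho> t) \<le> (\<Sum>t<n. \<theta> t * \<rho> (t + u)) + 2 * real u * variation_upto \<theta> n * M"
proof (induction u)
  case (Suc u)
  have "(\<Sum>t<n. \<theta> t * \<rho> (t + u)) \<le> (\<Sum>t<n. \<theta> t * \<rho> (Suc t + u)) + 2 * variation_upto \<theta> n * M"
    using eval_shift_one[OF \<theta>, of "\<lambda>t. \<rho> (t + u)"] \<rho> by simp
  with Suc show ?case by (simp add: algebra_simps)
qed simp

subsection \<open>A controlled chain observed through signals\<close>

text \<open>Beliefs are unnormalised: \<open>x k\<close> is the probability that the state is \<open>k\<close> and the signals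
  received so far are some fixed ones. Values become homogeneous of degree one, and averaging over
  the next signal \<open>d\<close> becomes a plain sum.\<close>

locale controlled_chain =
  fixes Q :: "'k::finite \<Rightarrow> 'i::finite \<Rightarrow> ('k \<times> 'd::finite) pmf"
    and g :: "'k \<Rightarrow> 'i \<Rightarrow> 'j::finite \<Rightarrow> real"
  assumes g_range: "0 \<le> g k i j \<and> g k i j \<le> 1"
begin

definition load :: "('k \<Rightarrow> real) \<Rightarrow> ('k \<Rightarrow> 'i pmf) \<Rightarrow> 'j \<Rightarrow> real" where
  "load x a j = (\<Sum>k\<in>UNIV. \<Sum>i\<in>UNIV. x k * pmf (a k) i * g k i j)"

text \<open>The minimum is over one \<open>j\<close> common to all states: player 2 replies to a
  known strategy, but sees signals only.\<close>

definition pay :: "('k \<Rightarrow> real) \<Rightarrow> ('k \<Rightarrow> 'i pmf) \<Rightarrow> real" where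
  "pay x a = Min (range (load x a))"

definition succ_belief :: "('k \<Rightarrow> real) \<Rightarrow> ('k \<Rightarrow> 'i pmf) \<Rightarrow> 'd \<Rightarrow> 'k \<Rightarrow> real" where
  "succ_belief x a d k' = (\<Sum>k\<in>UNIV. \<Sum>i\<in>UNIV. x k * pmf (a k) i * pmf (Q k i) (k', d))"

definition mass :: "('k \<Rightarrow> real) \<Rightarrow> real" where
  "mass x = (\<Sum>k\<in>UNIV. x k)"

text \<open>The expectation at date \<open>t\<close> of a function of the continuation strategy and
  the current belief. Giving \<open>F\<close> the strategy covers payoffs as well as functions of
  the belief alone, and lets dates compose.\<close>

fun iter :: "nat \<Rightarrow> ('d list \<Rightarrow> 'k \<Rightarrow> 'i pmf) \<Rightarrow> ('k \<Rightarrow> real) \<Rightarrow>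
    (('d list \<Rightarrow> 'k \<Rightarrow> 'i pmf) \<Rightarrow> ('k \<Rightarrow> real) \<Rightarrow> real) \<Rightarrow> real" where
  "iter 0 s x F = F s x"
| "iter (Suc t) s x F = (\<Sum>d\<in>UNIV. iter t (\<lambda>h. s (d # h)) (succ_belief x (s []) d) F)"

definition stage :: "nat \<Rightarrow> ('d list \<Rightarrow> 'k \<Rightarrow> 'i pmf) \<Rightarrow> ('k \<Rightarrow> real) \<Rightarrow> real" where
  "stage t s x = iter t s x (\<lambda>s x. pay x (s []))"

definition value_of :: "(nat \<Rightarrow> real) \<Rightarrow> nat \<Rightarrow> ('k \<Rightarrow> real) \<Rightarrow> real" where
  "value_of \<theta> n x = (SUP s. \<Sum>t<n. \<theta> t * stage t s x)"

lemma stage_0 [simp]: "stage 0 s x = pay x (s [])"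
  by (simp add: stage_def)

lemma stage_Suc [simp]:
  "stage (Suc t) s x = (\<Sum>d\<in>UNIV. stage t (\<lambda>h. s (d # h)) (succ_belief x (s []) d))"
  by (simp add: stage_def)

section \<open>Monotonicity, homogeneity and Lipschitz bounds in the belief\<close>

lemma succ_belief_mono: "\<forall>k. x k \<le> y k \<Longrightarrow> \<forall>k. succ_belief x a d k \<le> succ_belief y a d k"
  unfolding succ_belief_def by (intro allI sum_mono mult_right_mono) auto

lemma succ_belief_nonneg: "\<forall>k. 0 \<le> x k \<Longrightarrow> \<forall>k. 0 \<le> succ_belief x a d k"
  unfolding succ_belief_def by (intro allI sum_nonneg mult_nonneg_nonneg) auto

lemma mass_succ_belief: "(\<Sum>d\<in>UNIV. mass (succ_belief x a d)) = mass x"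
proof -
  have Q1: "(\<Sum>d\<in>UNIV. \<Sum>k'\<in>UNIV. pmf (Q k i) (k', d)) = 1" for k i
  proof -
    have "(\<Sum>d\<in>UNIV. \<Sum>k'\<in>UNIV. pmf (Q k i) (k', d)) = (\<Sum>z\<in>UNIV. pmf (Q k i) z)"
      by (subst sum.swap) (simp add: sum.cartesian_product flip: UNIV_Times_UNIV)
    then show ?thesis by (simp add: sum_pmf_eq_1)
  qed
  have "(\<Sum>d\<in>UNIV. mass (succ_belief x a d)) =
      (\<Sum>d\<in>UNIV. \<Sum>k'\<in>UNIV. \<Sum>k\<in>UNIV. \<Sum>i\<in>UNIV. x k * pmf (a k) i * pmf (Q k i) (k', d))"
    by (simp add: mass_def succ_belief_def)
  also have "\<dots> = (\<Sum>k\<in>UNIV. \<Sum>i\<in>UNIV. \<Sum>d\<in>UNIV. \<Sum>k'\<in>UNIV. x k * pmf (a k) i * pmf (Q k i) (k', d))"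
    apply (subst sum.swap[where A="UNIV::'i set" and B="UNIV::'d set"])
    apply (subst sum.swap[where A="UNIV::'i set" and B="UNIV::'k set"])
    apply (subst sum.swap[where A="UNIV::'k set" and B="UNIV::'d set"])
    apply (rule sum.cong[OF refl])
    apply (rule sum.swap)
    done
  also have "\<dots> = mass x"
    by (simp add: mass_def Q1 sum_pmf_eq_1 flip: sum_distrib_left)
  finally show ?thesis .
qed

lemma pay_le_load: "pay x a \<le> load x a j"
  by (simp add: pay_def)

lemma pay_greatest: "(\<And>j. c \<le> load x a j) \<Longrightarrow> c \<le> pay x a"
  by (simp add: pay_def)

lemma pay_attained: obtains j where "pay x a = load x a j"
proof -
  have "pay x a \<in> range (load x a)" unfolding pay_def by (rule Min_in) auto
  then show ?thesis using that by auto
qed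

lemma load_mono: "\<forall>k. x k \<le> y k \<Longrightarrow> load x a j \<le> load y a j"
  unfolding load_def using g_range by (intro sum_mono mult_right_mono) auto

text \<open>Payoffs are at most 1, so additional mass earns at most itself. The bound survives later
  stages because the total mass over all signals is preserved.\<close>

lemma load_diff_le:
  assumes "\<forall>k. x k \<le> y k" shows "load y a j \<le> load x a j + (mass y - mass x)"
proof -
  have "load y a j - load x a j = (\<Sum>k\<in>UNIV. \<Sum>i\<in>UNIV. (y k - x k) * pmf (a k) i * g k i j)"
    by (simp add: load_def sum_subtractf algebra_simps)
  also have "\<dots> \<le> (\<Sum>k\<in>UNIV. \<Sum>i\<in>UNIV. (y k - x k) * pmf (a k) i * 1)"
    using g_range assms by (intro sum_mono mult_left_mono) auto
  also have "\<dots> = mass y - mass x"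
    by (simp add: mass_def sum_pmf_eq_1 sum_subtractf flip: sum_distrib_left)
  finally show ?thesis by simp
qed

lemma pay_mono:
  assumes "\<forall>k. x k \<le> y k" shows "pay x a \<le> pay y a"
  by (rule pay_greatest) (rule order_trans[OF pay_le_load load_mono[OF assms]])

lemma pay_diff_le:
  assumes "\<forall>k. x k \<le> y k" shows "pay y a \<le> pay x a + (mass y - mass x)"
proof -
  obtain j where "pay x a = load x a j" by (rule pay_attained)
  then show ?thesis using pay_le_load[of y a j] load_diff_le[OF assms, of a j] by simp
qed

lemma succ_belief_scale: "succ_belief (\<lambda>k. c * x k) a d = (\<lambda>k. c * succ_belief x a d k)"
  by (rule ext) (simp add: succ_belief_def sum_distrib_left mult.assoc)

lemma load_scale: "load (\<lambda>k. c * x k) a j = c * load x a j"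
  by (simp add: load_def sum_distrib_left mult.assoc)

lemma pay_scale:
  assumes "0 \<le> c" shows "pay (\<lambda>k. c * x k) a = c * pay x a"
proof (rule antisym)
  obtain j where "pay x a = load x a j" by (rule pay_attained)
  then show "pay (\<lambda>k. c * x k) a \<le> c * pay x a"
    using pay_le_load[of "\<lambda>k. c * x k" a j] by (simp add: load_scale)
  show "c * pay x a \<le> pay (\<lambda>k. c * x k) a"
    by (rule pay_greatest) (simp add: load_scale mult_left_mono assms pay_le_load)
qed

lemma stage_scale: "0 \<le> c \<Longrightarrow> stage t s (\<lambda>k. c * x k) = c * stage t s x"
  by (induction t arbitrary: s x) (simp_all add: pay_scale succ_belief_scale sum_distrib_left)

lemma stage_mono: "\<forall>k. x k \<le> y k \<Longrightarrow> stage t s x \<le> stage t s y"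
proof (induction t arbitrary: s x y)
  case (Suc t)
  then show ?case unfolding stage_Suc by (intro sum_mono Suc.IH succ_belief_mono)
qed (simp add: pay_mono)

lemma stage_diff_le: "\<forall>k. x k \<le> y k \<Longrightarrow> stage t s y \<le> stage t s x + (mass y - mass x)"
proof (induction t arbitrary: s x y)
  case 0
  then show ?case by (simp add: pay_diff_le)
next
  case (Suc t)
  have "stage (Suc t) s y \<le> (\<Sum>d\<in>UNIV. stage t (\<lambda>h. s (d # h)) (succ_belief x (s []) d) +
      (mass (succ_belief y (s []) d) - mass (succ_belief x (s []) d)))"
    unfolding stage_Suc by (intro sum_mono Suc succ_belief_mono)
  then show ?case by (simp add: sum.distrib sum_subtractf mass_succ_belief)
qed

text \<open>Comparing with the zero belief turns monotonicity and the increment bound into the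
  bounds 0 and \<open>mass x\<close>.\<close>

lemma stage_zero: "stage t s (\<lambda>_. 0) = 0"
  using stage_scale[of 0 t s "\<lambda>_. 0"] by simp

lemma stage_nonneg: "\<forall>k. 0 \<le> x k \<Longrightarrow> 0 \<le> stage t s x"
  using stage_mono[of "\<lambda>_. 0" x t s] by (simp add: stage_zero)

lemma stage_le_mass: "\<forall>k. 0 \<le> x k \<Longrightarrow> stage t s x \<le> mass x"
  using stage_diff_le[of "\<lambda>_. 0" x t s] by (simp add: stage_zero mass_def)

lemma mass_nonneg: "\<forall>k. 0 \<le> x k \<Longrightarrow> 0 \<le> mass x"
  by (simp add: mass_def sum_nonneg)

lemma eval_stage_le_mass:
  assumes "finite_eval \<theta> n" "\<forall>k. 0 \<le> x k"
  shows "(\<Sum>t<n. \<theta> t * stage t s x) \<le> mass x"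
proof -
  have "(\<Sum>t<n. \<theta> t * stage t s x) \<le> (\<Sum>t<n. \<theta> t * mass x)"
    using assms by (intro sum_mono mult_left_mono stage_le_mass) (auto simp: finite_eval_def)
  then show ?thesis using assms by (simp add: finite_eval_def flip: sum_distrib_right)
qed

lemma value_upper:
  assumes "finite_eval \<theta> n" "\<forall>k. 0 \<le> x k"
  shows "(\<Sum>t<n. \<theta> t * stage t s x) \<le> value_of \<theta> n x"
  unfolding value_of_def
  by (rule cSUP_upper) (auto intro!: bdd_aboveI2 eval_stage_le_mass[OF assms])

lemma value_least:
  assumes "\<And>s. (\<Sum>t<n. \<theta> t * stage t s x) \<le> c"
  shows "value_of \<theta> n x \<le> c"
  unfolding value_of_def by (rule cSUP_least) (auto intro: assms)

lemma value_approx: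
  assumes "\<epsilon> > 0"
  obtains s where "value_of \<theta> n x - \<epsilon> < (\<Sum>t<n. \<theta> t * stage t s x)"
proof (rule ccontr)
  assume "\<not> thesis"
  then have "(\<Sum>t<n. \<theta> t * stage t s x) \<le> value_of \<theta> n x - \<epsilon>" for s
    using that linorder_not_less by blast
  then show False using value_least[of \<theta> x n "value_of \<theta> n x - \<epsilon>"] assms by simp
qed

lemma value_nonneg:
  assumes "finite_eval \<theta> n" "\<forall>k. 0 \<le> x k"
  shows "0 \<le> value_of \<theta> n x"
proof -
  have "0 \<le> (\<Sum>t<n. \<theta> t * stage t undefined x)"
    using assms by (intro sum_nonneg mult_nonneg_nonneg stage_nonneg) (auto simp: finite_eval_def)
  then show ?thesis using value_upper[OF assms] order_trans by blast
qed

lemma value_le_mass: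
  assumes "finite_eval \<theta> n" "\<forall>k. 0 \<le> x k"
  shows "value_of \<theta> n x \<le> mass x"
  by (intro value_least eval_stage_le_mass assms)

lemma value_mono:
  assumes \<theta>: "finite_eval \<theta> n" and x: "\<forall>k. 0 \<le> x k" "\<forall>k. x k \<le> y k"
  shows "value_of \<theta> n x \<le> value_of \<theta> n y"
proof (rule value_least)
  fix s
  have "(\<Sum>t<n. \<theta> t * stage t s x) \<le> (\<Sum>t<n. \<theta> t * stage t s y)"
    using \<theta> x by (intro sum_mono mult_left_mono stage_mono) (auto simp: finite_eval_def)
  also have "\<dots> \<le> value_of \<theta> n y"
    by (rule value_upper[OF \<theta>]) (use x in \<open>meson order_trans\<close>)
  finally show "(\<Sum>t<n. \<theta> t * stage t s x) \<le> value_of \<theta> n y" .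
qed

lemma value_diff_le:
  assumes \<theta>: "finite_eval \<theta> n" and x: "\<forall>k. 0 \<le> x k" "\<forall>k. x k \<le> y k"
  shows "value_of \<theta> n y \<le> value_of \<theta> n x + (mass y - mass x)"
proof (rule value_least)
  fix s
  have "(\<Sum>t<n. \<theta> t * stage t s y) \<le> (\<Sum>t<n. \<theta> t * (stage t s x + (mass y - mass x)))"
    using \<theta> x by (intro sum_mono mult_left_mono stage_diff_le) (auto simp: finite_eval_def)
  also have "\<dots> = (\<Sum>t<n. \<theta> t * stage t s x) + (mass y - mass x)"
    using \<theta> by (simp add: distrib_left sum.distrib finite_eval_def flip: sum_distrib_right)
  also have "\<dots> \<le> value_of \<theta> n x + (mass y - mass x)"
    using value_upper[OF \<theta> x(1)] by simp
  finally show "(\<Sum>t<n. \<theta> t * stage t s y) \<le> value_of \<theta> n x + (mass y - mass x)" .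
qed

text \<open>The pointwise minimum lies below both beliefs, and each exceeds it in mass by at most
  their l1 distance. The constant 1 is the same for all \<open>\<theta>\<close>, which gives
  equicontinuity.\<close>

lemma value_Lipschitz:
  assumes \<theta>: "finite_eval \<theta> n" and x: "\<forall>k. 0 \<le> x k" and y: "\<forall>k. 0 \<le> y k"
  shows "\<bar>value_of \<theta> n x - value_of \<theta> n y\<bar> \<le> (\<Sum>k\<in>UNIV. \<bar>x k - y k\<bar>)"
proof -
  let ?m = "\<lambda>k. min (x k) (y k)"
  have *: "value_of \<theta> n x \<le> value_of \<theta> n ?m + (mass x - mass ?m)"
       "value_of \<theta> n y \<le> value_of \<theta> n ?m + (mass y - mass ?m)"
       "value_of \<theta> n ?m \<le> value_of \<theta> n x" "value_of \<theta> n ?m \<le> value_of \<theta> n y"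
    using x y by (auto intro!: value_diff_le value_mono \<theta>)
  have "mass x - mass ?m \<le> (\<Sum>k\<in>UNIV. \<bar>x k - y k\<bar>)" "mass y - mass ?m \<le> (\<Sum>k\<in>UNIV. \<bar>x k - y k\<bar>)"
    unfolding mass_def sum_subtractf[symmetric] by (intro sum_mono; simp)+
  with * show ?thesis by linarith
qed

lemma value_scale:
  assumes \<theta>: "finite_eval \<theta> n" and x: "\<forall>k. 0 \<le> x k" and c: "0 \<le> c"
  shows "value_of \<theta> n (\<lambda>k. c * x k) = c * value_of \<theta> n x"
proof -
  have eq: "(\<Sum>t<n. \<theta> t * stage t s (\<lambda>k. c * x k)) = c * (\<Sum>t<n. \<theta> t * stage t s x)" for s
    by (simp add: stage_scale c sum_distrib_left mult_ac)
  show ?thesis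
  proof (cases "c = 0")
    case True
    then show ?thesis by (simp add: value_of_def eq[simplified True, simplified] stage_zero)
  next
    case False
    with c have c: "c > 0" by simp
    have "value_of \<theta> n (\<lambda>k. c * x k) \<le> c * value_of \<theta> n x"
      by (rule value_least) (use c value_upper[OF \<theta> x] in \<open>simp add: eq\<close>)
    moreover have "value_of \<theta> n x \<le> value_of \<theta> n (\<lambda>k. c * x k) / c"
    proof (rule value_least)
      fix s
      have "c * (\<Sum>t<n. \<theta> t * stage t s x) \<le> value_of \<theta> n (\<lambda>k. c * x k)"
        unfolding eq[symmetric] using c x by (intro value_upper[OF \<theta>]) simp
      then show "(\<Sum>t<n. \<theta> t * stage t s x) \<le> value_of \<theta> n (\<lambda>k. c * x k) / c"
        using c by (simp add: field_simps)
    qed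
    ultimately show ?thesis using c by (simp add: field_simps)
  qed
qed

text \<open>Playing \<open>a\<close> once and then almost optimally costs only a shift of the evaluation.\<close>

lemma value_almost_excessive:
  assumes \<theta>: "finite_eval \<theta> n" and x: "\<forall>k. 0 \<le> x k"
  shows "(\<Sum>d\<in>UNIV. value_of \<theta> n (succ_belief x a d)) \<le> value_of \<theta> n x + 2 * variation_upto \<theta> n * mass x"
proof (rule field_le_epsilon)
  fix e :: real assume e: "e > 0"
  define e' where "e' = e / real CARD('d)"
  have e': "e' > 0" using e by (simp add: e'_def)
  have "\<forall>d. \<exists>s. value_of \<theta> n (succ_belief x a d) - e' < (\<Sum>t<n. \<theta> t * stage t s (succ_belief x a d))"
    using value_approx[OF e'] by metis
  then obtain S where S: "\<And>d. value_of \<theta> n (succ_belief x a d) - e' < (\<Sum>t<n. \<theta> t * stage t (S d) (succ_belief x a d))"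
    by metis
  \<comment> \<open>Play \<open>a\<close> first, then the nearly optimal continuation for the signal
    received.\<close>
  define s where "s h = (case h of [] \<Rightarrow> a | d # h' \<Rightarrow> S d h')" for h
  have s: "stage (Suc t) s x = (\<Sum>d\<in>UNIV. stage t (S d) (succ_belief x a d))" for t
    by (simp add: s_def)
  have "(\<Sum>d\<in>UNIV. value_of \<theta> n (succ_belief x a d)) \<le> (\<Sum>d\<in>UNIV. (\<Sum>t<n. \<theta> t * stage t (S d) (succ_belief x a d)) + e')"
    using S by (intro sum_mono) (smt (verit))
  also have "\<dots> = (\<Sum>t<n. \<theta> t * stage (Suc t) s x) + e"
    unfolding s sum.distrib sum_distrib_left by (subst sum.swap) (simp add: e'_def)
  also have "\<dots> \<le> value_of \<theta> n x + 2 * variation_upto \<theta> n * mass x + e"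
  proof -
    have "(\<Sum>t<n. \<theta> t * stage (Suc t) s x) - (\<Sum>t<n. \<theta> (Suc t) * stage (Suc t) s x)
        = (\<Sum>t<n. (\<theta> t - \<theta> (Suc t)) * stage (Suc t) s x)"
      by (simp add: sum_subtractf left_diff_distrib del: stage_Suc)
    also have "\<dots> \<le> (\<Sum>t<n. \<bar>\<theta> (Suc t) - \<theta> t\<bar> * mass x)"
      by (intro sum_mono mult_mono) (use stage_le_mass[OF x] stage_nonneg[OF x] in \<open>auto simp del: stage_Suc\<close>)
    also have "\<dots> = variation_upto \<theta> n * mass x"
      by (simp add: variation_upto_def sum_distrib_right)
    also have "\<dots> \<le> 2 * variation_upto \<theta> n * mass x"
      using mass_nonneg[OF x] variation_upto_nonneg[of \<theta> n] by simp
    finally have "(\<Sum>t<n. \<theta> t * stage (Suc t) s x) \<le> (\<Sum>t<n. \<theta> (Suc t) * stage (Suc t) s x) + 2 * variation_upto \<theta> n * mass x"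
      by simp
    \<comment> \<open>Reindexing loses only the payoff of stage 0, which is nonnegative.\<close>
    also have "(\<Sum>t<n. \<theta> (Suc t) * stage (Suc t) s x) \<le> (\<Sum>t<Suc n. \<theta> t * stage t s x)"
      unfolding sum.lessThan_Suc_shift using \<theta> stage_nonneg[of x 0 s] x by (simp add: finite_eval_def del: stage_Suc)
    also have "\<dots> = (\<Sum>t<n. \<theta> t * stage t s x)"
      using \<theta> by (simp add: finite_eval_def)
    also have "\<dots> \<le> value_of \<theta> n x" by (rule value_upper[OF \<theta> x])
    finally show ?thesis by simp
  qed
  finally show "(\<Sum>d\<in>UNIV. value_of \<theta> n (succ_belief x a d)) \<le> value_of \<theta> n x + 2 * variation_upto \<theta> n * mass x + e" .
qed

section \<open>Restarting the chain at a later date\<close>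

lemma iter_add: "iter (t + u) s x F = iter t s x (\<lambda>s x. iter u s x F)"
  by (induction t arbitrary: s x) auto

lemma stage_add: "stage (t + u) s x = iter t s x (stage u)"
  by (simp add: stage_def[abs_def] iter_add)

lemma iter_mono:
  assumes "\<And>s x. \<forall>k. 0 \<le> x k \<Longrightarrow> F s x \<le> G s x" "\<forall>k. 0 \<le> x k"
  shows "iter t s x F \<le> iter t s x G"
  using assms(2)
proof (induction t arbitrary: s x)
  case (Suc t)
  then show ?case unfolding iter.simps by (intro sum_mono Suc.IH succ_belief_nonneg)
qed (simp add: assms(1))

lemma iter_sum: "iter t s x (\<lambda>s x. \<Sum>u\<in>A. F u s x) = (\<Sum>u\<in>A. iter t s x (F u))"
  by (induction t arbitrary: s x) (auto intro: sum.swap)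

lemma iter_scale: "iter t s x (\<lambda>s x. c * F s x) = c * iter t s x F"
  by (induction t arbitrary: s x) (auto simp: sum_distrib_left)

text \<open>Along the belief process \<open>w\<close> is a supermartingale under every strategy,
  because the one-step hypothesis covers all \<open>a\<close>.\<close>

lemma iter_excessive:
  assumes "\<And>x a. \<forall>k. 0 \<le> x k \<Longrightarrow> (\<Sum>d\<in>UNIV. w (succ_belief x a d)) \<le> w x" "\<forall>k. 0 \<le> x k"
  shows "iter t s x (\<lambda>_. w) \<le> w x"
  using assms(2)
proof (induction t arbitrary: s x)
  case (Suc t)
  have "iter (Suc t) s x (\<lambda>_. w) \<le> (\<Sum>d\<in>UNIV. w (succ_belief x (s []) d))"
    unfolding iter.simps by (intro sum_mono Suc.IH succ_belief_nonneg Suc.prems)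
  also have "\<dots> \<le> w x" by (intro assms(1) Suc.prems)
  finally show ?case .
qed simp

text \<open>Whatever evaluation \<open>\<theta>\<close> is used, restarting at a \<open>\<theta>\<close>-random date and then evaluating
  by \<open>\<eta>\<close> loses nothing beyond the variation of \<open>\<theta>\<close>: this exchanges the two evaluations.\<close>

lemma eval_le_restart:
  assumes \<theta>: "finite_eval \<theta> n" and \<eta>: "finite_eval \<eta> m" and x: "\<forall>k. 0 \<le> x k"
  shows "(\<Sum>t<n. \<theta> t * stage t s x) \<le>
    (\<Sum>t<n. \<theta> t * iter t s x (\<lambda>_. value_of \<eta> m)) + 2 * real m * variation_upto \<theta> n * mass x"
proof -
  \<comment> \<open>Inserting the total weight 1 of \<open>\<eta>\<close> allows a different shift
    \<open>u\<close> for each of its stages.\<close>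
  have "(\<Sum>t<n. \<theta> t * stage t s x) = (\<Sum>u<m. \<eta> u * (\<Sum>t<n. \<theta> t * stage t s x))"
    using \<eta> by (simp add: finite_eval_def flip: sum_distrib_right)
  also have "\<dots> \<le> (\<Sum>u<m. \<eta> u * ((\<Sum>t<n. \<theta> t * stage (t + u) s x) + 2 * real m * variation_upto \<theta> n * mass x))"
  proof (intro sum_mono mult_left_mono)
    fix u assume u: "u \<in> {..<m}"
    have "(\<Sum>t<n. \<theta> t * stage t s x) \<le> (\<Sum>t<n. \<theta> t * stage (t + u) s x) + 2 * real u * variation_upto \<theta> n * mass x"
      by (intro eval_shift \<theta> stage_nonneg stage_le_mass x)
    also have "2 * real u * variation_upto \<theta> n * mass x \<le> 2 * real m * variation_upto \<theta> n * mass x"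
      using u by (intro mult_right_mono) (auto simp: variation_upto_nonneg mass_nonneg x)
    finally show "(\<Sum>t<n. \<theta> t * stage t s x) \<le> (\<Sum>t<n. \<theta> t * stage (t + u) s x) + 2 * real m * variation_upto \<theta> n * mass x"
      by simp
  qed (use \<eta> in \<open>simp add: finite_eval_def\<close>)
  also have "\<dots> = (\<Sum>u<m. \<eta> u * (\<Sum>t<n. \<theta> t * stage (t + u) s x)) + 2 * real m * variation_upto \<theta> n * mass x"
    using \<eta> by (simp add: finite_eval_def distrib_left sum.distrib flip: sum_distrib_right)
  also have "(\<Sum>u<m. \<eta> u * (\<Sum>t<n. \<theta> t * stage (t + u) s x)) = (\<Sum>t<n. \<theta> t * (\<Sum>u<m. \<eta> u * iter t s x (stage u)))"
    unfolding sum_distrib_left stage_add by (subst sum.swap) (simp add: mult_ac)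
  also have "\<dots> = (\<Sum>t<n. \<theta> t * iter t s x (\<lambda>s x. \<Sum>u<m. \<eta> u * stage u s x))"
    by (simp add: iter_sum iter_scale)
  also have "\<dots> \<le> (\<Sum>t<n. \<theta> t * iter t s x (\<lambda>_. value_of \<eta> m))"
    using \<theta> x by (intro sum_mono mult_left_mono iter_mono value_upper[OF \<eta>]) (auto simp: finite_eval_def)
  finally show ?thesis by simp
qed

end

lemma le_of_le_scaled_epsilon:
  fixes a b M :: real
  assumes "\<And>e. 0 < e \<Longrightarrow> a \<le> b + e * M" "0 \<le> M"
  shows "a \<le> b"
proof (rule field_le_epsilon)
  fix e :: real assume e: "e > 0"
  have "a \<le> b + e / (M + 1) * M" using e assms(2) by (intro assms(1)) simp
  also have "e / (M + 1) * M \<le> e" using e assms(2) by (simp add: field_simps)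
  finally show "a \<le> b + e" by simp
qed

section \<open>Compactness of the values and uniqueness of their limit\<close>

context controlled_chain
begin

text \<open>On the simplex all values lie in [0,1] and share a Lipschitz constant, whatever the
  evaluations. The limit found there is extended homogeneously, so the error is proportional to
  \<open>mass x\<close>.\<close>

lemma value_subsequence_converges:
  assumes ev: "\<forall>j::nat. finite_eval (\<eta> j) (m j)"
  obtains w r where "strict_mono (r :: nat \<Rightarrow> nat)"
    "\<And>e. 0 < e \<Longrightarrow> \<exists>J. \<forall>j\<ge>J. \<forall>x. (\<forall>k. 0 \<le> x k) \<longrightarrow>
       \<bar>value_of (\<eta> (r j)) (m (r j)) x - w x\<bar> \<le> e * mass x"
proof -
  note \<eta> = ev[rule_format]
  define S where "S = {v::real^'k. (\<forall>k. 0 \<le> v $ k) \<and> (\<Sum>k\<in>UNIV. v $ k) = 1}"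
  define f where "f j v = value_of (\<eta> j) (m j) (\<lambda>k. v $ k)" for j and v :: "real^'k"
  have clS: "closed S"
    unfolding S_def by (intro closed_Collect_conj closed_Collect_all closed_Collect_le closed_Collect_eq continuous_intros)
  have "bounded S"
    unfolding bounded_iff
  proof (intro exI ballI)
    fix v assume "v \<in> S"
    then show "norm v \<le> 1" using norm_le_l1_cart[of v] by (simp add: S_def)
  qed
  with clS have cS: "compact S" by (simp add: compact_eq_bounded_closed)
  have fb: "norm (f j v) \<le> 1" if "v \<in> S" for j v
    using value_nonneg[OF \<eta>, of "\<lambda>k. v $ k" j] value_le_mass[OF \<eta>, of "\<lambda>k. v $ k" j] that
    by (simp add: f_def S_def mass_def)
  have fe: "\<exists>d. 0 < d \<and> (\<forall>n y. y \<in> S \<and> norm (x - y) < d \<longrightarrow> norm (f n x - f n y) < e)"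
    if "x \<in> S" "0 < e" for x e
  proof (intro exI[of _ "e / real CARD('k)"] conjI allI impI)
    fix n y assume y: "y \<in> S \<and> norm (x - y) < e / real CARD('k)"
    have "\<bar>f n x - f n y\<bar> \<le> (\<Sum>k\<in>UNIV. \<bar>x $ k - y $ k\<bar>)"
      unfolding f_def using that y by (intro value_Lipschitz \<eta>) (auto simp: S_def)
    also have "\<dots> \<le> (\<Sum>k\<in>(UNIV::'k set). norm (x - y))"
      by (intro sum_mono) (metis component_le_norm_cart vector_minus_component)
    also have "\<dots> = real CARD('k) * norm (x - y)" by simp
    also have "\<dots> < e" using y by (simp add: field_simps)
    finally show "norm (f n x - f n y) < e" by simp
  qed (use that in simp)
  obtain G r where r: "strict_mono (r :: nat \<Rightarrow> nat)"
    and G: "\<And>e. 0 < e \<Longrightarrow> \<exists>N. \<forall>n x. n \<ge> N \<and> x \<in> S \<longrightarrow> norm (f (r n) x - G x) < e"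
    using Arzela_Ascoli[OF cS fb fe] by metis
  \<comment> \<open>At mass 0 the quotient is meaningless, but the factor \<open>mass x\<close>
    makes \<open>w x\<close> equal to 0, like the values.\<close>
  define w where "w x = mass x * G (\<chi> k. x k / mass x)" for x
  show thesis
  proof (rule that[OF r, of w])
    fix e :: real assume "0 < e"
    then obtain J where J: "\<And>j v. j \<ge> J \<Longrightarrow> v \<in> S \<Longrightarrow> \<bar>f (r j) v - G v\<bar> < e" using G by fastforce
    show "\<exists>J. \<forall>j\<ge>J. \<forall>x. (\<forall>k. 0 \<le> x k) \<longrightarrow> \<bar>value_of (\<eta> (r j)) (m (r j)) x - w x\<bar> \<le> e * mass x"
    proof (intro exI[of _ J] allI impI)
      fix j and x :: "'k \<Rightarrow> real" assume j: "J \<le> j" and x: "\<forall>k. 0 \<le> x k"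
      show "\<bar>value_of (\<eta> (r j)) (m (r j)) x - w x\<bar> \<le> e * mass x"
      proof (cases "mass x = 0")
        case True
        then show ?thesis
          using value_nonneg[OF \<eta> x] value_le_mass[OF \<eta> x, of "r j"]
          by (simp add: w_def order_antisym)
      next
        case False
        then have M: "mass x > 0" using mass_nonneg[OF x] by simp
        let ?v = "\<chi> k. x k / mass x"
        have "?v \<in> S" using x M by (simp add: S_def sum_divide_distrib[symmetric]) (simp add: mass_def)
        then have d: "\<bar>f (r j) ?v - G ?v\<bar> \<le> e" using J[OF j] less_imp_le by blast
        have "value_of (\<eta> (r j)) (m (r j)) x = value_of (\<eta> (r j)) (m (r j)) (\<lambda>k. mass x * (x k / mass x))"
          using M by simp
        also have "\<dots> = mass x * f (r j) ?v"
        proof -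
          have v: "(\<lambda>k. ?v $ k) = (\<lambda>k. x k / mass x)" by (rule ext) simp
          show ?thesis
            unfolding f_def v by (subst value_scale[OF \<eta>]) (use x M in auto)
        qed
        finally have "\<bar>value_of (\<eta> (r j)) (m (r j)) x - w x\<bar> = mass x * \<bar>f (r j) ?v - G ?v\<bar>"
          using M by (simp add: w_def abs_mult flip: right_diff_distrib)
        also have "\<dots> \<le> mass x * e" using d M by (intro mult_left_mono) auto
        finally show ?thesis by (simp add: mult.commute)
      qed
    qed
  qed
qed

text \<open>If it fails along evaluations of vanishing variation, a subsequence of the
  \<open>\<eta>\<close> has a limit \<open>w\<close>, excessive because the defect in
  \<open>value_almost_excessive\<close> vanishes. One late \<open>\<eta>\<close>, kept fixed,
  restarts a much later \<open>\<theta>\<close> and bounds its value by nearly \<open>w\<close>,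
  hence by nearly the value of the \<open>\<eta>\<close> of the same index: a contradiction.\<close>

lemma value_uniformly_Cauchy:
  assumes \<epsilon>: "\<epsilon> > 0"
  shows "\<exists>\<alpha>>0. \<forall>\<theta> n \<eta> m x. finite_eval \<theta> n \<and> finite_eval \<eta> m \<and> variation_upto \<theta> n \<le> \<alpha> \<and>
    variation_upto \<eta> m \<le> \<alpha> \<and> (\<forall>k. 0 \<le> x k) \<longrightarrow> value_of \<theta> n x \<le> value_of \<eta> m x + \<epsilon> * mass x"
proof (rule ccontr)
  assume neg: "\<not> ?thesis"
  have "\<forall>j. \<exists>\<theta> n \<eta> m x. finite_eval \<theta> n \<and> finite_eval \<eta> m \<and> variation_upto \<theta> n \<le> inverse (real (Suc j)) \<and>
    variation_upto \<eta> m \<le> inverse (real (Suc j)) \<and> (\<forall>k. 0 \<le> x k) \<and> \<not> value_of \<theta> n x \<le> value_of \<eta> m x + \<epsilon> * mass x"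
  proof
    fix j :: nat
    have "inverse (real (Suc j)) > 0" by simp
    with neg show "\<exists>\<theta> n \<eta> m x. finite_eval \<theta> n \<and> finite_eval \<eta> m \<and> variation_upto \<theta> n \<le> inverse (real (Suc j)) \<and>
      variation_upto \<eta> m \<le> inverse (real (Suc j)) \<and> (\<forall>k. 0 \<le> x k) \<and> \<not> value_of \<theta> n x \<le> value_of \<eta> m x + \<epsilon> * mass x"
      by metis
  qed
  then obtain \<theta> n \<eta> m X where \<theta>: "\<And>j. finite_eval (\<theta> j) (n j)" and \<eta>: "\<And>j. finite_eval (\<eta> j) (m j)"
    and v\<theta>: "\<And>j. variation_upto (\<theta> j) (n j) \<le> inverse (real (Suc j))"
    and v\<eta>: "\<And>j. variation_upto (\<eta> j) (m j) \<le> inverse (real (Suc j))"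
    and X: "\<And>j. \<forall>k. 0 \<le> X j k"
    and bad: "\<And>j. \<not> value_of (\<theta> j) (n j) (X j) \<le> value_of (\<eta> j) (m j) (X j) + \<epsilon> * mass (X j)"
    unfolding choice_iff by blast
  obtain w r where r: "strict_mono (r :: nat \<Rightarrow> nat)" and w: "\<And>e. 0 < e \<Longrightarrow> \<exists>J. \<forall>j\<ge>J. \<forall>x. (\<forall>k. 0 \<le> x k) \<longrightarrow>
       \<bar>value_of (\<eta> (r j)) (m (r j)) x - w x\<bar> \<le> e * mass x"
    by (rule value_subsequence_converges[of \<eta> m]) (use \<eta> in blast)+
  have small: "\<exists>J. \<forall>j\<ge>J. inverse (real (Suc (r j))) < e" if e: "e > 0" for e
  proof -
    obtain J where J: "inverse (real (Suc J)) < e" using reals_Archimedean[OF e] by blast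
    show ?thesis
    proof (intro exI allI impI)
      fix j assume "J \<le> j"
      then have "J \<le> r j" using seq_suble[OF r, of j] by linarith
      then have "inverse (real (Suc (r j))) \<le> inverse (real (Suc J))" by (intro le_imp_inverse_le) auto
      with J show "inverse (real (Suc (r j))) < e" by linarith
    qed
  qed
  have exc: "(\<Sum>d\<in>UNIV. w (succ_belief x a d)) \<le> w x" if x: "\<forall>k. 0 \<le> x k" for x a
  \<comment> \<open>One \<open>e\<close> for each passage between \<open>w\<close> and its
    approximation, two from the variation: hence the 4.\<close>
  proof (rule le_of_le_scaled_epsilon[where M = "4 * mass x"])
    fix e :: real assume e: "e > 0"
    obtain J1 where J1: "\<And>j x. j \<ge> J1 \<Longrightarrow> \<forall>k. 0 \<le> x k \<Longrightarrow> \<bar>value_of (\<eta> (r j)) (m (r j)) x - w x\<bar> \<le> e * mass x"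
      using w[OF e] by blast
    obtain J2 where J2: "\<And>j. j \<ge> J2 \<Longrightarrow> inverse (real (Suc (r j))) < e" using small[OF e] by blast
    define j where "j = max J1 J2"
    let ?v = "value_of (\<eta> (r j)) (m (r j))"
    have vj: "variation_upto (\<eta> (r j)) (m (r j)) \<le> e"
      using v\<eta>[of "r j"] J2[of j] by (simp add: j_def)
    have "(\<Sum>d\<in>UNIV. w (succ_belief x a d)) \<le> (\<Sum>d\<in>UNIV. ?v (succ_belief x a d) + e * mass (succ_belief x a d))"
    proof (rule sum_mono)
      fix d
      show "w (succ_belief x a d) \<le> ?v (succ_belief x a d) + e * mass (succ_belief x a d)"
        using J1[of j "succ_belief x a d"] succ_belief_nonneg[OF x] by (simp add: j_def abs_le_iff)
    qed
    also have "\<dots> = (\<Sum>d\<in>UNIV. ?v (succ_belief x a d)) + e * mass x"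
      by (simp add: sum.distrib mass_succ_belief flip: sum_distrib_left)
    also have "\<dots> \<le> ?v x + 2 * variation_upto (\<eta> (r j)) (m (r j)) * mass x + e * mass x"
      using value_almost_excessive[OF \<eta> x] by simp
    also have "\<dots> \<le> ?v x + 2 * e * mass x + e * mass x"
      using vj mass_nonneg[OF x] by (simp add: mult_right_mono)
    also have "\<dots> \<le> w x + e * mass x + 2 * e * mass x + e * mass x"
      using J1[OF _ x, of j] by (simp add: j_def abs_le_iff)
    finally show "(\<Sum>d\<in>UNIV. w (succ_belief x a d)) \<le> w x + e * (4 * mass x)" by simp
  qed (use mass_nonneg[OF x] in simp)
  obtain J where J: "\<And>j x. j \<ge> J \<Longrightarrow> \<forall>k. 0 \<le> x k \<Longrightarrow> \<bar>value_of (\<eta> (r j)) (m (r j)) x - w x\<bar> \<le> \<epsilon> / 4 * mass x"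
    using w[of "\<epsilon> / 4"] \<epsilon> by auto
  \<comment> \<open>\<open>M\<close> is frozen before \<open>\<theta>\<close> is chosen: restarting
    costs \<open>2 * M\<close> times the variation of \<open>\<theta>\<close>, which can then be
    made at most \<open>\<epsilon> / 4\<close>.\<close>
  define M where "M = m (r J)"
  have Mpos: "M > 0" using \<eta>[of "r J"] by (cases M) (auto simp: finite_eval_def M_def)
  obtain J2 where J2: "\<And>j. j \<ge> J2 \<Longrightarrow> inverse (real (Suc (r j))) < \<epsilon> / (8 * real M)"
    using small[of "\<epsilon> / (8 * real M)"] \<epsilon> Mpos by auto
  define l where "l = max J J2"
  define x where "x = X (r l)"
  have x: "\<forall>k. 0 \<le> x k" using X by (simp add: x_def)
  let ?\<theta> = "\<theta> (r l)" and ?n = "n (r l)"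
  have var: "2 * real M * variation_upto ?\<theta> ?n \<le> \<epsilon> / 4"
  proof -
    have "variation_upto ?\<theta> ?n \<le> \<epsilon> / (8 * real M)" using v\<theta>[of "r l"] J2[of l] by (simp add: l_def)
    then show ?thesis using Mpos by (simp add: field_simps)
  qed
  have "value_of ?\<theta> ?n x \<le> w x + \<epsilon> / 4 * mass x + \<epsilon> / 4 * mass x"
  proof (rule value_least)
    fix s
    have it: "iter t s x (\<lambda>_. value_of (\<eta> (r J)) M) \<le> w x + \<epsilon> / 4 * mass x" for t
    proof -
      have le: "value_of (\<eta> (r J)) M y \<le> w y + \<epsilon> / 4 * mass y" if "\<forall>k. 0 \<le> y k" for y
        using J[OF order_refl that] unfolding M_def by linarith
      have "iter t s x (\<lambda>_. value_of (\<eta> (r J)) M) \<le> iter t s x (\<lambda>_ x. w x + \<epsilon> / 4 * mass x)"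
        by (rule iter_mono[OF le x])
      \<comment> \<open>Adding a multiple of \<open>mass\<close> keeps \<open>w\<close> excessive,
        since mass is preserved in total over the signals.\<close>
      also have "\<dots> \<le> w x + \<epsilon> / 4 * mass x"
        by (rule iter_excessive[OF _ x])
          (simp only: sum.distrib mass_succ_belief sum_distrib_left[symmetric] add_le_cancel_right, rule exc)
      finally show ?thesis .
    qed
    have "(\<Sum>t<?n. ?\<theta> t * stage t s x) \<le> (\<Sum>t<?n. ?\<theta> t * iter t s x (\<lambda>_. value_of (\<eta> (r J)) M)) + 2 * real M * variation_upto ?\<theta> ?n * mass x"
      unfolding M_def by (rule eval_le_restart[OF \<theta> \<eta> x])
    also have "\<dots> \<le> (\<Sum>t<?n. ?\<theta> t * (w x + \<epsilon> / 4 * mass x)) + \<epsilon> / 4 * mass x"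
      using \<theta>[of "r l"] by (intro add_mono sum_mono mult_left_mono mult_right_mono it var mass_nonneg x) (simp add: finite_eval_def)
    also have "\<dots> = w x + \<epsilon> / 4 * mass x + \<epsilon> / 4 * mass x"
      using \<theta>[of "r l"] by (simp add: finite_eval_def flip: sum_distrib_right)
    finally show "(\<Sum>t<?n. ?\<theta> t * stage t s x) \<le> w x + \<epsilon> / 4 * mass x + \<epsilon> / 4 * mass x" .
  qed
  also have "w x \<le> value_of (\<eta> (r l)) (m (r l)) x + \<epsilon> / 4 * mass x"
  proof -
    have "J \<le> l" by (simp add: l_def)
    from J[OF this x] show ?thesis by linarith
  qed
  finally have "value_of ?\<theta> ?n x \<le> value_of (\<eta> (r l)) (m (r l)) x + 3 / 4 * \<epsilon> * mass x" by simp
  also have "3 / 4 * \<epsilon> * mass x \<le> \<epsilon> * mass x" using \<epsilon> mass_nonneg[OF x] by (intro mult_right_mono) auto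
  finally show False using bad[of "r l"] by (simp add: x_def)
qed

end

subsection \<open>A minimax lemma\<close>

text \<open>The right side is \<open>(max 0 a - h * b)\<^sup>2\<close>, and raising \<open>a\<close>
  to \<open>max 0 a\<close> can only enlarge the positive part. It is the second-order expansion of
  the penalty in the step \<open>h\<close>.\<close>

lemma pos_part_square_le:
  fixes a b h :: real
  shows "(max 0 (a - h * b))\<^sup>2 \<le> (max 0 a)\<^sup>2 - 2 * h * b * max 0 a + h\<^sup>2 * b\<^sup>2"
proof -
  have "(max 0 a)\<^sup>2 - 2 * h * b * max 0 a + h\<^sup>2 * b\<^sup>2 = (max 0 a - h * b)\<^sup>2"
    by (simp add: power2_eq_square algebra_simps)
  moreover have "(max 0 (a - h * b))\<^sup>2 \<le> (max 0 a - h * b)\<^sup>2"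
    by (cases "a - h * b \<le> 0"; cases "a \<le> 0") (auto simp: max_def intro!: power_mono simp: power2_eq_square mult_mono)
  ultimately show ?thesis by simp
qed

text \<open>\<open>C\<close> is a set of payoff vectors that is convex up to domination. A near-minimiser \<open>u\<close> of the
  quadratic penalty \<open>\<Sum> (\<delta> - u s)\<^sub>+\<^sup>2\<close> yields the weights \<open>(\<delta> - u s)\<^sub>+\<close>, because moving
  from \<open>u\<close> towards any other \<open>u'\<close> hardly decreases the penalty.\<close>

lemma minimax_weights:
  fixes C :: "('s \<Rightarrow> real) set"
  assumes S: "finite S" and bnd: "\<And>u s. u \<in> C \<Longrightarrow> s \<in> S \<Longrightarrow> \<bar>u s\<bar> \<le> B"
    and conv: "\<And>u u' h. u \<in> C \<Longrightarrow> u' \<in> C \<Longrightarrow> 0 \<le> h \<Longrightarrow> h \<le> 1 \<Longrightarrow>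
       \<exists>u''\<in>C. \<forall>s\<in>S. (1 - h) * u s + h * u' s \<le> u'' s"
    and low: "\<And>u. u \<in> C \<Longrightarrow> \<exists>s\<in>S. u s \<le> c" and ne: "C \<noteq> {}" and \<delta>: "\<delta> > 0"
  obtains \<mu> where "\<And>s. s \<in> S \<Longrightarrow> 0 \<le> \<mu> s" "(\<Sum>s\<in>S. \<mu> s) = 1"
    "\<And>u. u \<in> C \<Longrightarrow> (\<Sum>s\<in>S. \<mu> s * u s) \<le> c + \<delta>"
proof -
  define \<Phi> where "\<Phi> u = (\<Sum>s\<in>S. (max 0 (c + \<delta> - u s))\<^sup>2)" for u
  have \<Phi>_ge: "\<delta>\<^sup>2 \<le> \<Phi> u" if u: "u \<in> C" for u
  proof -
    obtain s where s: "s \<in> S" "u s \<le> c" using low[OF u] by blast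
    have "\<delta>\<^sup>2 \<le> (max 0 (c + \<delta> - u s))\<^sup>2" using s \<delta> by (intro power_mono) auto
    also have "\<dots> \<le> \<Phi> u" unfolding \<Phi>_def using s S by (intro member_le_sum) auto
    finally show ?thesis .
  qed
  \<comment> \<open>\<open>R\<close> bounds the second-order coefficient, and \<open>+ 1\<close>
    keeps it positive. The step \<open>h\<close> is short enough that the second-order term stays
    below \<open>h * \<delta>\<^sup>2\<close>, which is also the gap allowed from the
    infimum.\<close>
  define R where "R = (\<Sum>s\<in>S. (2 * B)\<^sup>2) + 1"
  have R: "R > 0" unfolding R_def by (intro add_nonneg_pos sum_nonneg) auto
  define h where "h = min 1 (\<delta>\<^sup>2 / R)"
  have h: "0 < h" "h \<le> 1" "h * R \<le> \<delta>\<^sup>2" using \<delta> R by (auto simp: h_def min_def field_simps)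
  define I where "I = Inf (\<Phi> ` C)"
  have bdd: "bdd_below (\<Phi> ` C)" using \<Phi>_ge by (auto intro!: bdd_belowI2)
  have "\<exists>z\<in>\<Phi> ` C. z < I + h * \<delta>\<^sup>2"
    unfolding I_def using ne bdd h \<delta> by (intro iffD1[OF cInf_less_iff]) auto
  then obtain u where u: "u \<in> C" and uI: "\<Phi> u < I + h * \<delta>\<^sup>2" by blast
  define w where "w s = max 0 (c + \<delta> - u s)" for s
  have \<Phi>w: "\<Phi> u = (\<Sum>s\<in>S. (w s)\<^sup>2)" by (simp add: \<Phi>_def w_def)
  define W where "W = (\<Sum>s\<in>S. w s)"
  have w0: "0 \<le> w s" for s by (simp add: w_def)
  have Wpos: "W > 0"
  proof -
    obtain s where s: "s \<in> S" "u s \<le> c" using low[OF u] by blast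
    have "0 < w s" using s \<delta> by (simp add: w_def)
    also have "w s \<le> W" unfolding W_def using s S w0 by (intro member_le_sum) auto
    finally show ?thesis .
  qed
  have main: "(\<Sum>s\<in>S. w s * u' s) \<le> (c + \<delta>) * W" if u': "u' \<in> C" for u'
  proof -
    obtain u'' where u'': "u'' \<in> C" "\<And>s. s \<in> S \<Longrightarrow> (1 - h) * u s + h * u' s \<le> u'' s"
      using conv[OF u u', of h] h by auto
    have "\<Phi> u - h * \<delta>\<^sup>2 \<le> \<Phi> u''" using uI cInf_lower[OF _ bdd, of "\<Phi> u''"] u'' by (auto simp: I_def)
    also have "\<dots> \<le> (\<Sum>s\<in>S. (w s)\<^sup>2 - 2 * h * (u' s - u s) * w s + h\<^sup>2 * (u' s - u s)\<^sup>2)"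
      unfolding \<Phi>_def
    proof (rule sum_mono)
      fix s assume s: "s \<in> S"
      have "(max 0 (c + \<delta> - u'' s))\<^sup>2 \<le> (max 0 ((c + \<delta> - u s) - h * (u' s - u s)))\<^sup>2"
        using u''(2)[OF s] by (intro power_mono) (auto simp: algebra_simps)
      also have "\<dots> \<le> (w s)\<^sup>2 - 2 * h * (u' s - u s) * w s + h\<^sup>2 * (u' s - u s)\<^sup>2"
        unfolding w_def by (rule pos_part_square_le)
      finally show "(max 0 (c + \<delta> - u'' s))\<^sup>2 \<le> (w s)\<^sup>2 - 2 * h * (u' s - u s) * w s + h\<^sup>2 * (u' s - u s)\<^sup>2" .
    qed
    also have "\<dots> = \<Phi> u - 2 * h * (\<Sum>s\<in>S. w s * (u' s - u s)) + h\<^sup>2 * (\<Sum>s\<in>S. (u' s - u s)\<^sup>2)"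
      by (simp add: \<Phi>w sum.distrib sum_subtractf sum_distrib_left mult_ac)
    also have "(\<Sum>s\<in>S. (u' s - u s)\<^sup>2) \<le> (\<Sum>s\<in>S. (2 * B)\<^sup>2)"
    proof (rule sum_mono)
      fix s assume s: "s \<in> S"
      have "\<bar>u' s - u s\<bar> \<le> \<bar>2 * B\<bar>" using bnd[OF u s] bnd[OF u' s] by linarith
      then show "(u' s - u s)\<^sup>2 \<le> (2 * B)\<^sup>2" by (simp add: abs_le_square_iff)
    qed
    also have "\<dots> \<le> R" by (simp add: R_def)
    finally have "2 * h * (\<Sum>s\<in>S. w s * (u' s - u s)) \<le> h * \<delta>\<^sup>2 + h\<^sup>2 * R" by (simp add: mult_left_mono)
    also have "\<dots> = h * (\<delta>\<^sup>2 + h * R)" by (simp add: power2_eq_square algebra_simps)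
    also have "\<dots> \<le> h * (2 * \<delta>\<^sup>2)" using h by (intro mult_left_mono) auto
    finally have "(\<Sum>s\<in>S. w s * (u' s - u s)) \<le> \<delta>\<^sup>2" using h by simp
    moreover have "(\<Sum>s\<in>S. w s * u s) = (c + \<delta>) * W - \<Phi> u"
    proof -
      \<comment> \<open>Where \<open>w s\<close> is positive, \<open>u s\<close> equals
        \<open>c + \<delta> - w s\<close>.\<close>
      have "w s * u s = (c + \<delta>) * w s - (w s)\<^sup>2" for s
        by (auto simp: w_def max_def power2_eq_square algebra_simps)
      then show ?thesis by (simp add: W_def \<Phi>w sum_subtractf sum_distrib_left)
    qed
    \<comment> \<open>The two errors, \<open>\<delta>\<^sup>2\<close> together after division by
      \<open>2 * h\<close>, are absorbed by the penalty: it is at least that large because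
      \<open>u\<close> falls to \<open>c\<close> somewhere.\<close>
    moreover have "\<delta>\<^sup>2 \<le> \<Phi> u" by (rule \<Phi>_ge[OF u])
    ultimately show ?thesis by (simp add: right_diff_distrib sum_subtractf)
  qed
  show thesis
  proof (rule that[of "\<lambda>s. w s / W"])
    show "(\<Sum>s\<in>S. w s / W) = 1" using Wpos by (simp add: W_def flip: sum_divide_distrib)
    show "(\<Sum>s\<in>S. w s / W * u' s) \<le> c + \<delta>" if "u' \<in> C" for u'
      using main[OF that] Wpos by (simp add: divide_le_eq flip: sum_divide_distrib)
  qed (use w0 Wpos in auto)
qed

lemma pmf_of_weights:
  fixes f :: "'a::finite \<Rightarrow> real"
  assumes "\<And>a. 0 \<le> f a" "(\<Sum>a\<in>UNIV. f a) = 1"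
  obtains p where "\<And>a. pmf p a = f a"
proof -
  have "(\<integral>\<^sup>+ a. ennreal (f a) \<partial>count_space UNIV) = 1"
    using assms by (simp add: nn_integral_count_space_finite)
  then have "pmf (embed_pmf f) a = f a" for a
    using assms by (intro pmf_embed_pmf) auto
  then show thesis by (rule that)
qed

lemma range_Min_attained:
  fixes f :: "'j::finite \<Rightarrow> real"
  obtains j where "Min (range f) = f j"
proof -
  have "Min (range f) \<in> range f" by (rule Min_in) auto
  then show ?thesis by (rule rangeE) (rule that)
qed

text \<open>The second player's pure strategies choose one \<open>j\<close> at every \<open>a \<in> A\<close>; since payoffs are sums
  over \<open>A\<close>, only the marginals of a mixture of them matter.\<close>

lemma minimax_separable:
  fixes C :: "('a \<Rightarrow> 'j::finite \<Rightarrow> real) set"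
  assumes A: "finite A" and bnd: "\<And>u a j. u \<in> C \<Longrightarrow> a \<in> A \<Longrightarrow> \<bar>u a j\<bar> \<le> B"
    and conv: "\<And>u u' h. u \<in> C \<Longrightarrow> u' \<in> C \<Longrightarrow> 0 \<le> h \<Longrightarrow> h \<le> 1 \<Longrightarrow>
       \<exists>u''\<in>C. \<forall>a\<in>A. \<forall>j. (1 - h) * u a j + h * u' a j = u'' a j"
    and low: "\<And>u. u \<in> C \<Longrightarrow> (\<Sum>a\<in>A. Min (range (u a))) \<le> c" and ne: "C \<noteq> {}" and \<delta>: "\<delta> > 0"
  obtains T :: "'a \<Rightarrow> 'j pmf" where "\<And>u. u \<in> C \<Longrightarrow> (\<Sum>a\<in>A. \<Sum>j\<in>UNIV. pmf (T a) j * u a j) \<le> c + \<delta>"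
proof -
  define P where "P = PiE A (\<lambda>_. UNIV :: 'j set)"
  have fP: "finite P" unfolding P_def by (intro finite_PiE A) auto
  define D where "D = (\<lambda>u s. \<Sum>a\<in>A. u a (s a)) ` C"
  have D_bnd: "\<bar>v s\<bar> \<le> real (card A) * B" if "v \<in> D" for v s
  proof -
    from that obtain u where u: "u \<in> C" "v = (\<lambda>s. \<Sum>a\<in>A. u a (s a))" by (auto simp: D_def)
    have "\<bar>v s\<bar> \<le> (\<Sum>a\<in>A. \<bar>u a (s a)\<bar>)" unfolding u by (rule sum_abs)
    also have "\<dots> \<le> (\<Sum>a\<in>A. B)" by (intro sum_mono bnd u)
    finally show ?thesis by simp
  qed
  have D_conv: "\<exists>v''\<in>D. \<forall>s\<in>P. (1 - h) * v s + h * v' s \<le> v'' s"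
    if v: "v \<in> D" "v' \<in> D" and h: "0 \<le> h" "h \<le> 1" for v v' h
  proof -
    from v obtain u u' where u: "u \<in> C" "v = (\<lambda>s. \<Sum>a\<in>A. u a (s a))"
      "u' \<in> C" "v' = (\<lambda>s. \<Sum>a\<in>A. u' a (s a))" by (auto simp: D_def)
    obtain u'' where u'': "u'' \<in> C" "\<forall>a\<in>A. \<forall>j. (1 - h) * u a j + h * u' a j = u'' a j"
      using conv[OF u(1,3) h] by blast
    have eq: "(\<Sum>a\<in>A. u'' a (s a)) = (1 - h) * v s + h * v' s" for s
      unfolding u sum_distrib_left sum.distrib[symmetric] using u'' by (intro sum.cong) auto
    have "(\<lambda>s. \<Sum>a\<in>A. u'' a (s a)) \<in> D" unfolding D_def using u''(1) by (rule imageI)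
    then show ?thesis by (rule bexI[rotated]) (simp add: eq)
  qed
  have D_low: "\<exists>s\<in>P. v s \<le> c" if "v \<in> D" for v
  proof -
    from that obtain u where u: "u \<in> C" "v = (\<lambda>s. \<Sum>a\<in>A. u a (s a))" by (auto simp: D_def)
    \<comment> \<open>Minimisers chosen separately at each \<open>a\<close> form one pure strategy,
      so a sum of minima is the payoff of a pure reply.\<close>
    have "\<exists>j. u a j = Min (range (u a))" for a by (metis range_Min_attained)
    then obtain j where j: "\<And>a. u a (j a) = Min (range (u a))" by metis
    have "v (restrict j A) \<le> c" using low[OF u(1)] unfolding u(2) by (simp add: j)
    then show ?thesis by (auto simp: P_def)
  qed
  obtain \<mu> where \<mu>: "\<And>s. s \<in> P \<Longrightarrow> 0 \<le> \<mu> s" "(\<Sum>s\<in>P. \<mu> s) = 1"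
    and \<mu>D: "\<And>v. v \<in> D \<Longrightarrow> (\<Sum>s\<in>P. \<mu> s * v s) \<le> c + \<delta>"
  proof (rule minimax_weights[of P D "real (card A) * B" c \<delta>])
    show "D \<noteq> {}" using ne by (simp add: D_def)
  next
    fix \<mu> assume "\<And>s. s \<in> P \<Longrightarrow> 0 \<le> \<mu> s" "(\<Sum>s\<in>P. \<mu> s) = 1"
      "\<And>v. v \<in> D \<Longrightarrow> (\<Sum>s\<in>P. \<mu> s * v s) \<le> c + \<delta>"
    then show thesis by (rule that)
  qed (use fP D_bnd D_conv D_low \<delta> in blast)+
  define f where "f a j = (\<Sum>s\<in>P. \<mu> s * (if s a = j then 1 else 0))" for a j
  have "\<exists>p. \<forall>j. pmf p j = f a j" for a
  proof -
    have "(\<Sum>j\<in>UNIV. f a j) = 1" unfolding f_def by (subst sum.swap) (simp add: \<mu> flip: sum_distrib_left)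
    moreover have "0 \<le> f a j" for j unfolding f_def using \<mu> by (intro sum_nonneg) auto
    ultimately show ?thesis by (metis pmf_of_weights)
  qed
  then obtain T where T: "\<And>a j. pmf (T a) j = f a j" by metis
  show thesis
  proof (rule that)
    fix u assume u: "u \<in> C"
    have "(\<Sum>a\<in>A. \<Sum>j\<in>UNIV. pmf (T a) j * u a j) =
        (\<Sum>a\<in>A. \<Sum>j\<in>UNIV. \<Sum>s\<in>P. \<mu> s * (if s a = j then u a j else 0))"
      unfolding T f_def sum_distrib_right by (intro sum.cong refl) auto
    also have "\<dots> = (\<Sum>a\<in>A. \<Sum>s\<in>P. \<mu> s * u a (s a))"
      by (intro sum.cong refl, subst sum.swap) (simp flip: sum_distrib_left)
    also have "\<dots> = (\<Sum>s\<in>P. \<mu> s * (\<Sum>a\<in>A. u a (s a)))"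
      unfolding sum_distrib_left by (rule sum.swap)
    also have "\<dots> \<le> c + \<delta>" by (rule \<mu>D) (use u in \<open>auto simp: D_def\<close>)
    finally show "(\<Sum>a\<in>A. \<Sum>j\<in>UNIV. pmf (T a) j * u a j) \<le> c + \<delta>" .
  qed
qed

subsection \<open>Flows\<close>

lemma finite_lists_of_length [simp]: "finite {h::'a::finite list. length h = n}"
  using finite_lists_length_eq[of "UNIV :: 'a set" n] by simp

lemma sum_lists_of_length_Suc:
  "(\<Sum>h | length h = Suc n. F h) = (\<Sum>d\<in>UNIV. \<Sum>h | length h = n. F (d # h))"
  for F :: "'a::finite list \<Rightarrow> 'b::comm_monoid_add"
proof -
  have "{h::'a list. length h = Suc n} = (\<lambda>(d, h). d # h) ` (UNIV \<times> {h. length h = n})"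
    by (auto simp: length_Suc_conv image_iff)
  moreover have "inj_on (\<lambda>(d, h). d # h) (UNIV \<times> {h::'a list. length h = n})"
    by (auto simp: inj_on_def)
  ultimately show ?thesis by (simp add: sum.reindex sum.cartesian_product case_prod_unfold)
qed

context controlled_chain
begin

fun occ :: "('d list \<Rightarrow> 'k \<Rightarrow> 'i pmf) \<Rightarrow> ('k \<Rightarrow> real) \<Rightarrow> 'd list \<Rightarrow> 'k \<Rightarrow> real" where
  "occ s x [] = x"
| "occ s x (d # h) = occ (\<lambda>h'. s (d # h')) (succ_belief x (s []) d) h"

lemma occ_snoc: "occ s x (h @ [d]) = succ_belief (occ s x h) (s h) d"
  by (induction h arbitrary: s x) auto

lemma occ_nonneg: "\<forall>k. 0 \<le> x k \<Longrightarrow> \<forall>k. 0 \<le> occ s x h k"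
  by (induction h arbitrary: s x) (simp, metis occ.simps(2) succ_belief_nonneg)

lemma mass_succ_belief_le:
  assumes x: "\<forall>k. 0 \<le> x k" shows "mass (succ_belief x a d) \<le> mass x"
proof -
  have "mass (succ_belief x a d) \<le> (\<Sum>d\<in>UNIV. mass (succ_belief x a d))"
    by (rule member_le_sum) (auto simp: mass_nonneg succ_belief_nonneg[OF x])
  then show ?thesis by (simp add: mass_succ_belief)
qed

lemma mass_occ_le: "\<forall>k. 0 \<le> x k \<Longrightarrow> mass (occ s x h) \<le> mass x"
proof (induction h arbitrary: s x)
  case (Cons d h)
  show ?case
    using Cons.IH[OF succ_belief_nonneg[OF Cons.prems]] mass_succ_belief_le[OF Cons.prems]
    by (metis occ.simps(2) order_trans)
qed simp

lemma stage_eq_sum: "stage t s x = (\<Sum>h | length h = t. pay (occ s x h) (s h))"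
  by (induction t arbitrary: s x) (simp_all add: sum_lists_of_length_Suc)

text \<open>\<open>Y h k i\<close> is the probability that player 2's signals so far, the initial one included, are \<open>h\<close>,
  the state is \<open>k\<close> and the action is \<open>i\<close>; \<open>Y []\<close> is irrelevant.\<close>

definition is_flow :: "('d \<Rightarrow> 'k \<Rightarrow> real) \<Rightarrow> ('d list \<Rightarrow> 'k \<Rightarrow> 'i \<Rightarrow> real) \<Rightarrow> bool" where
  "is_flow x0 Y \<longleftrightarrow> (\<forall>h k i. 0 \<le> Y h k i) \<and> (\<forall>d k. (\<Sum>i\<in>UNIV. Y [d] k i) = x0 d k) \<and>
     (\<forall>h d k. h \<noteq> [] \<longrightarrow> (\<Sum>i\<in>UNIV. Y (h @ [d]) k i) =
        (\<Sum>k0\<in>UNIV. \<Sum>i0\<in>UNIV. Y h k0 i0 * pmf (Q k0 i0) (k, d)))"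

definition flow_load :: "('d list \<Rightarrow> 'k \<Rightarrow> 'i \<Rightarrow> real) \<Rightarrow> 'd list \<Rightarrow> 'j \<Rightarrow> real" where
  "flow_load Y h j = (\<Sum>k\<in>UNIV. \<Sum>i\<in>UNIV. Y h k i * g k i j)"

text \<open>Stages count from 0 while \<open>h\<close> contains the initial signal, hence the length
  \<open>Suc t\<close>.\<close>

definition flow_stage :: "nat \<Rightarrow> ('d list \<Rightarrow> 'k \<Rightarrow> 'i \<Rightarrow> real) \<Rightarrow> real" where
  "flow_stage t Y = (\<Sum>h | length h = Suc t. Min (range (flow_load Y h)))"

text \<open>The head of \<open>h\<close> selects the initial belief. The value at \<open>[]\<close>
  is a placeholder compatible with the sign condition of \<open>is_flow\<close>.\<close>

definition belief_at :: "('d \<Rightarrow> 'k \<Rightarrow> real) \<Rightarrow> ('d list \<Rightarrow> 'k \<Rightarrow> 'i pmf) \<Rightarrow> 'd list \<Rightarrow> 'k \<Rightarrow> real" where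
  "belief_at x0 S h = (case h of [] \<Rightarrow> (\<lambda>_. 0) | d # h' \<Rightarrow> occ (\<lambda>h. S (d # h)) (x0 d) h')"

definition flow_of :: "('d \<Rightarrow> 'k \<Rightarrow> real) \<Rightarrow> ('d list \<Rightarrow> 'k \<Rightarrow> 'i pmf) \<Rightarrow> 'd list \<Rightarrow> 'k \<Rightarrow> 'i \<Rightarrow> real" where
  "flow_of x0 S h k i = belief_at x0 S h k * pmf (S h k) i"

lemma belief_at_snoc: "h \<noteq> [] \<Longrightarrow> belief_at x0 S (h @ [d]) = succ_belief (belief_at x0 S h) (S h) d"
  by (cases h) (simp_all add: belief_at_def occ_snoc)

lemma sum_flow_of: "(\<Sum>i\<in>UNIV. flow_of x0 S h k i) = belief_at x0 S h k"
  by (simp add: flow_of_def sum_pmf_eq_1 flip: sum_distrib_left)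

lemma belief_at_nonneg: "\<forall>d k. 0 \<le> x0 d k \<Longrightarrow> 0 \<le> belief_at x0 S h k"
  using occ_nonneg by (auto simp: belief_at_def split: list.splits)

lemma is_flow_flow_of:
  assumes "\<forall>d k. 0 \<le> x0 d k" shows "is_flow x0 (flow_of x0 S)"
  unfolding is_flow_def sum_flow_of
  using belief_at_nonneg[OF assms]
  by (auto simp: flow_of_def belief_at_snoc succ_belief_def) (simp add: belief_at_def)

lemma flow_load_flow_of: "flow_load (flow_of x0 S) h = load (belief_at x0 S h) (S h)"
  by (rule ext) (simp add: flow_load_def flow_of_def load_def)

lemma flow_stage_flow_of: "flow_stage t (flow_of x0 S) = (\<Sum>d\<in>UNIV. stage t (\<lambda>h. S (d # h)) (x0 d))"
  unfolding flow_stage_def flow_load_flow_of sum_lists_of_length_Suc stage_eq_sum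
  by (simp add: belief_at_def pay_def)

lemma flow_stage_cong: "(\<And>h. h \<noteq> [] \<Longrightarrow> Y h = Y' h) \<Longrightarrow> flow_stage t Y = flow_stage t Y'"
  unfolding flow_stage_def flow_load_def by (intro sum.cong refl) (auto simp: length_Suc_conv)

text \<open>By induction on the signals, the state marginals follow from the previous step once the
  conditional law of the action is \<open>S\<close>. This serves both to disintegrate flows and to
  identify the flow of an actual play.\<close>

lemma flow_determined:
  assumes Y: "is_flow x0 Y"
    and S: "\<And>h k i. h \<noteq> [] \<Longrightarrow> Y h k i = (\<Sum>i\<in>UNIV. Y h k i) * pmf (S h k) i" and h: "h \<noteq> []"
  shows "Y h = flow_of x0 S h"
proof -
  have "(\<Sum>i\<in>UNIV. Y h k i) = belief_at x0 S h k" for k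
    using h
  proof (induction h arbitrary: k rule: rev_induct)
    case (snoc d h)
    show ?case
    proof (cases "h = []")
      case True
      then show ?thesis using Y by (simp add: is_flow_def belief_at_def)
    next
      case False
      have "(\<Sum>i\<in>UNIV. Y (h @ [d]) k i) = (\<Sum>k0\<in>UNIV. \<Sum>i0\<in>UNIV. Y h k0 i0 * pmf (Q k0 i0) (k, d))"
        using Y False by (simp add: is_flow_def)
      also have "\<dots> = (\<Sum>k0\<in>UNIV. \<Sum>i0\<in>UNIV. (belief_at x0 S h k0 * pmf (S h k0) i0) * pmf (Q k0 i0) (k, d))"
        by (intro sum.cong refl arg_cong2[where f = "(*)"]) (use S[OF False] snoc.IH[OF False] in metis)
      also have "\<dots> = belief_at x0 S (h @ [d]) k"
        by (simp add: belief_at_snoc[OF False] succ_belief_def)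
      finally show ?thesis .
    qed
  qed simp
  then show ?thesis
    unfolding flow_of_def fun_eq_iff using S[OF h] by metis
qed

text \<open>\<open>S\<close> is the conditional law of the action given signals and state, arbitrary
  where the marginal vanishes. So the linear constraints describe exactly what strategies can
  achieve.\<close>

lemma flow_eq_flow_of:
  assumes Y: "is_flow x0 Y"
  obtains S where "\<And>h. h \<noteq> [] \<Longrightarrow> Y h = flow_of x0 S h"
proof -
  have "\<exists>p. \<forall>i. Y h k i = (\<Sum>i\<in>UNIV. Y h k i) * pmf p i" for h k
  proof (cases "(\<Sum>i\<in>UNIV. Y h k i) = 0")
    case True
    then have "Y h k i = 0" for i using Y by (subst (asm) sum_nonneg_eq_0_iff) (auto simp: is_flow_def)
    then show ?thesis by simp
  next
    case False
    let ?M = "\<Sum>i\<in>UNIV. Y h k i"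
    have "0 \<le> ?M" using Y by (intro sum_nonneg) (auto simp: is_flow_def)
    with False have M: "?M > 0" by simp
    obtain p where "\<And>i. pmf p i = Y h k i / ?M"
      by (rule pmf_of_weights[of "\<lambda>i. Y h k i / ?M"])
        (use Y M in \<open>auto simp: is_flow_def simp flip: sum_divide_distrib\<close>)
    then show ?thesis using M by (intro exI[of _ p]) simp
  qed
  then obtain S where "\<And>h k i. Y h k i = (\<Sum>i\<in>UNIV. Y h k i) * pmf (S h k) i" by metis
  then show thesis by (intro that flow_determined[OF Y])
qed

lemma flow_stage_eq_stage:
  assumes Y: "is_flow x0 Y"
  obtains S where "\<And>t. flow_stage t Y = (\<Sum>d\<in>UNIV. stage t (\<lambda>h. S (d # h)) (x0 d))"
proof -
  obtain S where "\<And>h. h \<noteq> [] \<Longrightarrow> Y h = flow_of x0 S h" by (rule flow_eq_flow_of[OF Y]) blast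
  then have "flow_stage t Y = flow_stage t (flow_of x0 S)" for t by (rule flow_stage_cong)
  then show thesis by (intro that) (simp add: flow_stage_flow_of)
qed

lemma flow_value_upper:
  assumes Y: "is_flow x0 Y" and x0: "\<forall>d k. 0 \<le> x0 d k" and \<theta>: "finite_eval \<theta> n"
  shows "(\<Sum>t<n. \<theta> t * flow_stage t Y) \<le> (\<Sum>d\<in>UNIV. value_of \<theta> n (x0 d))"
proof -
  obtain S where S: "\<And>t. flow_stage t Y = (\<Sum>d\<in>UNIV. stage t (\<lambda>h. S (d # h)) (x0 d))"
    by (rule flow_stage_eq_stage[OF Y]) blast
  have "(\<Sum>t<n. \<theta> t * flow_stage t Y) = (\<Sum>d\<in>UNIV. \<Sum>t<n. \<theta> t * stage t (\<lambda>h. S (d # h)) (x0 d))"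
    unfolding S sum_distrib_left by (rule sum.swap)
  also have "\<dots> \<le> (\<Sum>d\<in>UNIV. value_of \<theta> n (x0 d))"
    using x0 by (intro sum_mono value_upper[OF \<theta>]) auto
  finally show ?thesis .
qed

text \<open>Distinct initial signals allow unrelated continuations, so strategies nearly optimal for
  each \<open>x0 d\<close> combine into one flow.\<close>

lemma flow_value_approx:
  assumes x0: "\<forall>d k. 0 \<le> x0 d k" and e: "e > 0"
  obtains Y where "is_flow x0 Y" "(\<Sum>d\<in>UNIV. value_of \<theta> n (x0 d)) - e \<le> (\<Sum>t<n. \<theta> t * flow_stage t Y)"
proof -
  define e' where "e' = e / real CARD('d)"
  have e': "e' > 0" using e by (simp add: e'_def)
  have "\<forall>d. \<exists>s. value_of \<theta> n (x0 d) - e' < (\<Sum>t<n. \<theta> t * stage t s (x0 d))"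
    using value_approx[OF e'] by metis
  then obtain s where s: "\<And>d. value_of \<theta> n (x0 d) - e' < (\<Sum>t<n. \<theta> t * stage t (s d) (x0 d))"
    by metis
  define S where "S h = s (hd h) (tl h)" for h
  have "(\<Sum>d\<in>UNIV. value_of \<theta> n (x0 d)) - e = (\<Sum>d\<in>UNIV. value_of \<theta> n (x0 d) - e')"
    by (simp add: sum_subtractf e'_def)
  also have "\<dots> \<le> (\<Sum>d\<in>UNIV. \<Sum>t<n. \<theta> t * stage t (s d) (x0 d))"
    using s by (intro sum_mono less_imp_le)
  also have "\<dots> = (\<Sum>t<n. \<theta> t * flow_stage t (flow_of x0 S))"
    unfolding flow_stage_flow_of sum_distrib_left by (subst sum.swap) (simp add: S_def)
  finally show thesis using that is_flow_flow_of[OF x0] by blast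
qed

lemma flow_stage_bounds:
  assumes Y: "is_flow x0 Y" and x0: "\<forall>d k. 0 \<le> x0 d k" and m: "(\<Sum>d\<in>UNIV. mass (x0 d)) = 1"
  shows "0 \<le> flow_stage t Y" "flow_stage t Y \<le> 1"
proof -
  obtain S where S: "\<And>t. flow_stage t Y = (\<Sum>d\<in>UNIV. stage t (\<lambda>h. S (d # h)) (x0 d))"
    by (rule flow_stage_eq_stage[OF Y]) blast
  show "0 \<le> flow_stage t Y" unfolding S using x0 by (intro sum_nonneg stage_nonneg) auto
  show "flow_stage t Y \<le> 1" unfolding S m[symmetric] using x0 by (intro sum_mono stage_le_mass) auto
qed

lemma flow_le_1:
  assumes Y: "is_flow x0 Y" and x0: "\<forall>d k. 0 \<le> x0 d k" and m: "(\<Sum>d\<in>UNIV. mass (x0 d)) = 1"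
    and h: "h \<noteq> []"
  shows "(\<Sum>k\<in>UNIV. \<Sum>i\<in>UNIV. Y h k i) \<le> 1" "Y h k i \<le> 1"
proof -
  obtain S where S: "\<And>h. h \<noteq> [] \<Longrightarrow> Y h = flow_of x0 S h" by (rule flow_eq_flow_of[OF Y]) blast
  obtain d h' where dh: "h = d # h'" using h by (cases h) auto
  have "(\<Sum>k\<in>UNIV. \<Sum>i\<in>UNIV. Y h k i) = mass (occ (\<lambda>h. S (d # h)) (x0 d) h')"
    by (simp add: S[OF h] sum_flow_of mass_def) (simp add: dh belief_at_def)
  also have "\<dots> \<le> mass (x0 d)" using x0 by (intro mass_occ_le) auto
  also have "\<dots> \<le> (\<Sum>d\<in>UNIV. mass (x0 d))" by (rule member_le_sum) (use x0 in \<open>auto intro: mass_nonneg\<close>)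
  finally show 1: "(\<Sum>k\<in>UNIV. \<Sum>i\<in>UNIV. Y h k i) \<le> 1" by (simp add: m)
  have nn: "0 \<le> Y h k i" for k i using Y by (simp add: is_flow_def)
  have "Y h k i \<le> (\<Sum>i\<in>UNIV. Y h k i)" by (rule member_le_sum) (auto simp: nn)
  also have "\<dots> \<le> (\<Sum>k\<in>UNIV. \<Sum>i\<in>UNIV. Y h k i)" by (rule member_le_sum) (auto simp: nn sum_nonneg)
  finally show "Y h k i \<le> 1" using 1 by simp
qed

lemma is_flow_convex:
  assumes Y: "is_flow x0 Y" "is_flow x0 Y'" and c: "0 \<le> c" "c \<le> 1"
  shows "is_flow x0 (\<lambda>h k i. (1 - c) * Y h k i + c * Y' h k i)"
proof -
  have "(\<Sum>i\<in>UNIV. (1 - c) * Y [d] k i + c * Y' [d] k i) = x0 d k" for d k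
    using Y by (simp add: is_flow_def sum.distrib flip: sum_distrib_left) (simp add: algebra_simps)
  moreover have "(\<Sum>i\<in>UNIV. (1 - c) * Y (h @ [d]) k i + c * Y' (h @ [d]) k i) =
      (\<Sum>k0\<in>UNIV. \<Sum>i0\<in>UNIV. ((1 - c) * Y h k0 i0 + c * Y' h k0 i0) * pmf (Q k0 i0) (k, d))" if "h \<noteq> []" for h d k
    using Y that
    by (simp add: is_flow_def sum.distrib distrib_right mult.assoc flip: sum_distrib_left)
  ultimately show ?thesis using Y c by (simp add: is_flow_def)
qed

lemma flow_load_convex:
  "flow_load (\<lambda>h k i. (1 - c) * Y h k i + c * Y' h k i) h j = (1 - c) * flow_load Y h j + c * flow_load Y' h j"
  by (simp add: flow_load_def sum.distrib distrib_right mult.assoc sum_distrib_left)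

text \<open>A sum of minima of functions linear in the flow.\<close>

lemma flow_stage_concave:
  assumes c: "0 \<le> c" "c \<le> 1"
  shows "(1 - c) * flow_stage t Y + c * flow_stage t Y' \<le> flow_stage t (\<lambda>h k i. (1 - c) * Y h k i + c * Y' h k i)"
  unfolding flow_stage_def sum_distrib_left sum.distrib[symmetric]
proof (rule sum_mono)
  fix h :: "'d list"
  have "(1 - c) * Min (range (flow_load Y h)) + c * Min (range (flow_load Y' h)) \<le>
      (1 - c) * flow_load Y h j + c * flow_load Y' h j" for j
    using c by (intro add_mono mult_left_mono) auto
  then show "(1 - c) * Min (range (flow_load Y h)) + c * Min (range (flow_load Y' h)) \<le>
      Min (range (flow_load (\<lambda>h k i. (1 - c) * Y h k i + c * Y' h k i) h))"
    by (simp add: flow_load_convex)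
qed

lemma flow_load_bounds:
  assumes Y: "is_flow x0 Y" and x0: "\<forall>d k. 0 \<le> x0 d k" and m: "(\<Sum>d\<in>UNIV. mass (x0 d)) = 1"
    and h: "h \<noteq> []"
  shows "0 \<le> flow_load Y h j" "flow_load Y h j \<le> 1"
proof -
  have nn: "0 \<le> Y h k i" for k i using Y by (simp add: is_flow_def)
  show "0 \<le> flow_load Y h j" unfolding flow_load_def using g_range nn by (intro sum_nonneg mult_nonneg_nonneg) auto
  have "flow_load Y h j \<le> (\<Sum>k\<in>UNIV. \<Sum>i\<in>UNIV. Y h k i * 1)"
    unfolding flow_load_def using g_range nn by (intro sum_mono mult_left_mono) auto
  also have "\<dots> \<le> 1" using flow_le_1[OF assms] by simp
  finally show "flow_load Y h j \<le> 1" .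
qed

text \<open>Compactness: the infinite-horizon flow is a pointwise limit along a diagonal subsequence.\<close>

lemma flow_block_limit:
  assumes Y: "\<And>n::nat. is_flow x0 (Y n)" and x0: "\<forall>d k. 0 \<le> x0 d k" and m: "(\<Sum>d\<in>UNIV. mass (x0 d)) = 1"
    and B: "\<And>n l. l < n \<Longrightarrow> finite (B l) \<and> c \<le> (\<Sum>t\<in>B l. flow_stage t (Y n))"
  obtains Z where "is_flow x0 Z" "\<And>l. c \<le> (\<Sum>t\<in>B l. flow_stage t Z)"
proof -
  \<comment> \<open>A flow is not bounded above at the empty history; setting that entry to 0 keeps
    the family bounded.\<close>
  define f where "f = (\<lambda>n (h, k, i). if h = [] then 0 else Y n h k i)"
  have "norm (f n z) \<le> 1" for n z
    using flow_le_1(2)[OF Y x0 m] Y by (auto simp: f_def is_flow_def split: prod.splits)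
  then obtain r l where r: "strict_mono (r :: nat \<Rightarrow> nat)" and l: "\<And>z. (\<lambda>n. f (r n) z) \<longlonglongrightarrow> l z"
    using function_convergent_subsequence[of "UNIV :: ('d list \<times> 'k \<times> 'i) set" f 1] by (metis countableI_type UNIV_I)
  define Z where "Z h k i = l (h, k, i)" for h k i
  have lim: "(\<lambda>n. Y (r n) h k i) \<longlonglongrightarrow> Z h k i" if "h \<noteq> []" for h k i
    using l[of "(h, k, i)"] that by (simp add: f_def Z_def)
  have Z: "is_flow x0 Z"
    unfolding is_flow_def
  proof (intro conjI allI impI)
    fix h k i
    show "0 \<le> Z h k i" unfolding Z_def
      by (rule LIMSEQ_le_const[OF l]) (use Y in \<open>auto simp: f_def is_flow_def\<close>)
  next
    fix d k
    have "(\<lambda>n. \<Sum>i\<in>UNIV. Y (r n) [d] k i) \<longlonglongrightarrow> (\<Sum>i\<in>UNIV. Z [d] k i)"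
      by (intro tendsto_sum lim) simp
    then show "(\<Sum>i\<in>UNIV. Z [d] k i) = x0 d k"
      using Y by (simp add: is_flow_def LIMSEQ_const_iff)
  next
    fix h :: "'d list" and d k assume h: "h \<noteq> []"
    have "(\<lambda>n. \<Sum>i\<in>UNIV. Y (r n) (h @ [d]) k i) \<longlonglongrightarrow> (\<Sum>i\<in>UNIV. Z (h @ [d]) k i)"
      by (intro tendsto_sum lim) simp
    moreover have "(\<lambda>n. \<Sum>k0\<in>UNIV. \<Sum>i0\<in>UNIV. Y (r n) h k0 i0 * pmf (Q k0 i0) (k, d)) \<longlonglongrightarrow>
        (\<Sum>k0\<in>UNIV. \<Sum>i0\<in>UNIV. Z h k0 i0 * pmf (Q k0 i0) (k, d))"
      by (intro tendsto_sum tendsto_mult lim h tendsto_const)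
    moreover have "(\<Sum>i\<in>UNIV. Y (r n) (h @ [d]) k i) = (\<Sum>k0\<in>UNIV. \<Sum>i0\<in>UNIV. Y (r n) h k0 i0 * pmf (Q k0 i0) (k, d))" for n
      using Y h by (simp add: is_flow_def)
    ultimately show "(\<Sum>i\<in>UNIV. Z (h @ [d]) k i) = (\<Sum>k0\<in>UNIV. \<Sum>i0\<in>UNIV. Z h k0 i0 * pmf (Q k0 i0) (k, d))"
      using LIMSEQ_unique by simp
  qed
  have "c \<le> (\<Sum>t\<in>B b. flow_stage t Z)" for b
  proof -
    \<comment> \<open>Freeze the replies optimal against the limit. Against the approximating flows
      they yield at least the minimum, and with fixed replies the payoff is linear and passes to the
      limit.\<close>
    have "\<exists>j. flow_load Z h j = Min (range (flow_load Z h))" for h by (metis range_Min_attained)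
    then obtain j where j: "\<And>h. flow_load Z h (j h) = Min (range (flow_load Z h))" by metis
    have "(\<lambda>n. \<Sum>t\<in>B b. \<Sum>h | length h = Suc t. flow_load (Y (r n)) h (j h)) \<longlonglongrightarrow>
        (\<Sum>t\<in>B b. \<Sum>h | length h = Suc t. flow_load Z h (j h))"
      unfolding flow_load_def by (intro tendsto_sum tendsto_mult lim tendsto_const) auto
    moreover have "c \<le> (\<Sum>t\<in>B b. \<Sum>h | length h = Suc t. flow_load (Y (r n)) h (j h))" if "n \<ge> Suc b" for n
    proof -
      have "b < r n" using that seq_suble[OF r, of n] by linarith
      then have "c \<le> (\<Sum>t\<in>B b. flow_stage t (Y (r n)))" using B by blast
      also have "\<dots> \<le> (\<Sum>t\<in>B b. \<Sum>h | length h = Suc t. flow_load (Y (r n)) h (j h))"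
        unfolding flow_stage_def by (intro sum_mono) simp
      finally show ?thesis .
    qed
    ultimately have "c \<le> (\<Sum>t\<in>B b. \<Sum>h | length h = Suc t. flow_load Z h (j h))"
      using LIMSEQ_le_const by blast
    then show ?thesis by (simp add: j flow_stage_def)
  qed
  with Z show thesis by (rule that)
qed

end

subsection \<open>Blocks of stages\<close>

definition block :: "nat \<Rightarrow> nat \<Rightarrow> nat set" where
  "block N l = {l * N..<l * N + N}"

definition block_eval :: "nat \<Rightarrow> nat \<Rightarrow> nat \<Rightarrow> real" where
  "block_eval N l t = (if t \<in> block N l then 1 / real N else 0)"

lemma card_block [simp]: "card (block N l) = N" and finite_block [simp]: "finite (block N l)"
  by (simp_all add: block_def)

lemma block_bound: "l < L \<Longrightarrow> t \<in> block N l \<Longrightarrow> t < L * N"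
  by (metis (no_types, lifting) Suc_leI atLeastLessThan_iff block_def mult_Suc mult_le_mono1 add.commute order_less_le_trans)

lemma sum_block_eval:
  assumes "l < L"
  shows "(\<Sum>t<L * N. block_eval N l t * f t) = (\<Sum>t\<in>block N l. f t) / real N"
proof -
  have "(\<Sum>t<L * N. block_eval N l t * f t) = (\<Sum>t\<in>block N l. f t / real N)"
    using block_bound[OF assms] by (intro sum.mono_neutral_cong_right) (auto simp: block_eval_def)
  then show ?thesis by (simp add: sum_divide_distrib)
qed

text \<open>At most two jumps of height \<open>1 / real N\<close>, wherever the block lies; for
  \<open>l = 0\<close> the upward jump is absent.\<close>

lemma variation_block_eval: "variation_upto (block_eval N l) n \<le> 2 / real N"
proof -
  have one: "(\<Sum>t<n. if Suc t = c then 1 / real N else 0) \<le> 1 / real N" for c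
    by (cases c) auto
  have "variation_upto (block_eval N l) n \<le>
      (\<Sum>t<n. (if Suc t = l * N then 1 / real N else 0) + (if Suc t = l * N + N then 1 / real N else 0))"
    unfolding variation_upto_def by (rule sum_mono) (auto simp: block_eval_def block_def)
  also have "\<dots> \<le> 1 / real N + 1 / real N" unfolding sum.distrib by (intro add_mono one)
  finally show ?thesis by simp
qed

text \<open>Variation is convex, so the bound is the same for all weights and every number
  \<open>L\<close> of blocks. Hence a single \<open>N\<close> makes the values of all mixtures close
  to the limit.\<close>

lemma block_mixture:
  assumes N: "N > 0" and \<mu>: "\<And>l. l < L \<Longrightarrow> 0 \<le> \<mu> l" "(\<Sum>l<L. \<mu> l) = 1"
  defines "\<theta> \<equiv> \<lambda>t. \<Sum>l<L. \<mu> l * block_eval N l t"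
  shows "finite_eval \<theta> (L * N)" "variation_upto \<theta> (L * N) \<le> 2 / real N"
    "(\<Sum>t<L * N. \<theta> t * f t) = (\<Sum>l<L. \<mu> l * ((\<Sum>t\<in>block N l. f t) / real N))"
proof -
  show *: "(\<Sum>t<L * N. \<theta> t * f t) = (\<Sum>l<L. \<mu> l * ((\<Sum>t\<in>block N l. f t) / real N))" for f
  proof -
    have "(\<Sum>t<L * N. \<theta> t * f t) = (\<Sum>l<L. \<mu> l * (\<Sum>t<L * N. block_eval N l t * f t))"
      unfolding \<theta>_def sum_distrib_right sum_distrib_left by (subst sum.swap) (simp add: mult.assoc)
    then show ?thesis by (simp add: sum_block_eval)
  qed
  show "finite_eval \<theta> (L * N)"
    unfolding finite_eval_def
  proof (intro conjI allI impI)
    show "0 \<le> \<theta> t" for t unfolding \<theta>_def using \<mu> by (intro sum_nonneg) (auto simp: block_eval_def)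
    show "\<theta> t = 0" if "L * N \<le> t" for t
      unfolding \<theta>_def by (rule sum.neutral) (use block_bound that in \<open>force simp: block_eval_def\<close>)
    show "(\<Sum>t<L * N. \<theta> t) = 1" using *[of "\<lambda>_. 1"] N \<mu> by simp
  qed
  have "variation_upto \<theta> (L * N) \<le> (\<Sum>t<L * N. \<Sum>l<L. \<mu> l * \<bar>block_eval N l (Suc t) - block_eval N l t\<bar>)"
    unfolding variation_upto_def
  proof (rule sum_mono)
    fix t
    have "\<bar>\<theta> (Suc t) - \<theta> t\<bar> \<le> (\<Sum>l<L. \<bar>\<mu> l * (block_eval N l (Suc t) - block_eval N l t)\<bar>)"
      unfolding \<theta>_def sum_subtractf[symmetric] right_diff_distrib[symmetric] by (rule sum_abs)
    also have "\<dots> = (\<Sum>l<L. \<mu> l * \<bar>block_eval N l (Suc t) - block_eval N l t\<bar>)"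
      using \<mu> by (intro sum.cong) (auto simp: abs_mult)
    finally show "\<bar>\<theta> (Suc t) - \<theta> t\<bar> \<le> (\<Sum>l<L. \<mu> l * \<bar>block_eval N l (Suc t) - block_eval N l t\<bar>)" .
  qed
  also have "\<dots> = (\<Sum>l<L. \<mu> l * variation_upto (block_eval N l) (L * N))"
    unfolding variation_upto_def sum_distrib_left by (rule sum.swap)
  also have "\<dots> \<le> (\<Sum>l<L. \<mu> l * (2 / real N))"
    using \<mu> by (intro sum_mono mult_left_mono variation_block_eval) auto
  also have "\<dots> = 2 / real N" unfolding sum_distrib_right[symmetric] \<mu> by simp
  finally show "variation_upto \<theta> (L * N) \<le> 2 / real N" .
qed

lemma finite_eval_block_eval: "N > 0 \<Longrightarrow> finite_eval (block_eval N l) (Suc l * N)"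
  unfolding finite_eval_def
  using sum_block_eval[of l "Suc l" N "\<lambda>_. 1"] block_bound[of l "Suc l" _ N]
  by (auto simp: block_eval_def not_less[symmetric])

lemma evaluation_block_sum_ge:
  assumes \<theta>: "\<And>t. 0 \<le> \<theta> t" and f: "\<And>t. \<bar>f t\<bar> \<le> 1" and blk: "\<And>l. 0 \<le> (\<Sum>t\<in>block N l. f t)"
  shows "- (real N * (\<Sum>t<L * N. \<bar>\<theta> (Suc t) - \<theta> t\<bar>)) \<le> (\<Sum>t<L * N. \<theta> t * f t)"
proof (induction L)
  case (Suc L)
  have split: "(\<Sum>t<Suc L * N. F t) = (\<Sum>t<L * N. F t) + (\<Sum>t\<in>block N L. F t)" for F :: "nat \<Rightarrow> real"
  proof -
    have eq: "{..<Suc L * N} = {..<L * N} \<union> block N L" by (auto simp: block_def)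
    show ?thesis unfolding eq by (rule sum.union_disjoint) (auto simp: block_def)
  qed
  define V where "V = (\<Sum>t\<in>block N L. \<bar>\<theta> (Suc t) - \<theta> t\<bar>)"
  have near: "\<bar>\<theta> t - \<theta> (L * N)\<bar> \<le> V" if t: "t \<in> block N L" for t
  proof -
    have "\<theta> t - \<theta> (L * N) = (\<Sum>s\<in>{L * N..<t}. \<theta> (Suc s) - \<theta> s)"
      using t by (subst sum_Suc_diff') (auto simp: block_def)
    then have "\<bar>\<theta> t - \<theta> (L * N)\<bar> \<le> (\<Sum>s\<in>{L * N..<t}. \<bar>\<theta> (Suc s) - \<theta> s\<bar>)"
      by (simp add: sum_abs)
    also have "\<dots> \<le> V" unfolding V_def using t by (intro sum_mono2) (auto simp: block_def)
    finally show ?thesis .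
  qed
  have "- (real N * V) \<le> \<theta> (L * N) * (\<Sum>t\<in>block N L. f t) + (\<Sum>t\<in>block N L. - V)"
    using \<theta> blk by simp
  also have "(\<Sum>t\<in>block N L. - V) \<le> (\<Sum>t\<in>block N L. (\<theta> t - \<theta> (L * N)) * f t)"
  proof (rule sum_mono)
    fix t assume t: "t \<in> block N L"
    have "\<bar>(\<theta> t - \<theta> (L * N)) * f t\<bar> \<le> V * 1"
      unfolding abs_mult using near[OF t] f by (intro mult_mono) auto
    then show "- V \<le> (\<theta> t - \<theta> (L * N)) * f t" by linarith
  qed
  also have "\<theta> (L * N) * (\<Sum>t\<in>block N L. f t) + (\<Sum>t\<in>block N L. (\<theta> t - \<theta> (L * N)) * f t) = (\<Sum>t\<in>block N L. \<theta> t * f t)"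
    by (simp add: sum_distrib_left sum.distrib[symmetric] algebra_simps)
  finally have "- (real N * V) \<le> (\<Sum>t\<in>block N L. \<theta> t * f t)" by simp
  with Suc show ?case unfolding split V_def[symmetric] by (simp add: distrib_left)
qed simp

lemma evaluation_block_average:
  assumes \<theta>: "is_evaluation \<theta>" and \<rho>: "\<And>t. 0 \<le> \<rho> t" "\<And>t. \<rho> t \<le> 1" and N: "N > 0"
    and avg: "\<And>l. c * real N \<le> (\<Sum>t\<in>block N l. \<rho> t)"
  shows "c - real N * total_variation \<theta> \<le> (\<Sum>t. \<theta> t * \<rho> t)"
proof -
  \<comment> \<open>Centring needs \<open>\<bar>\<rho> t - b\<bar> \<le> 1\<close>, so a negative
    \<open>c\<close> is raised to 0; block sums of the nonnegative \<open>\<rho>\<close> still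
    satisfy the bound.\<close>
  define b where "b = max 0 c"
  have \<theta>0: "\<And>t. 0 \<le> \<theta> t" and \<theta>1: "\<theta> sums 1" using \<theta> by (auto simp: is_evaluation_def)
  have sm: "summable \<theta>" using \<theta>1 by (rule sums_summable)
  have sd: "summable (\<lambda>t. \<bar>\<theta> (Suc t) - \<theta> t\<bar>)"
  proof (rule summable_comparison_test'[of "\<lambda>t. \<theta> (Suc t) + \<theta> t" 0])
    show "summable (\<lambda>t. \<theta> (Suc t) + \<theta> t)" using sm by (intro summable_add) (auto simp: summable_Suc_iff)
    show "norm \<bar>\<theta> (Suc t) - \<theta> t\<bar> \<le> \<theta> (Suc t) + \<theta> t" for t using \<theta>0[of t] \<theta>0[of "Suc t"] by simp
  qed
  have s\<rho>: "summable (\<lambda>t. \<theta> t * \<rho> t)"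
    by (rule summable_comparison_test'[OF sm, of 0]) (use \<theta>0 \<rho> in \<open>auto simp: abs_mult mult_left_le\<close>)
  have bavg: "b * real N \<le> (\<Sum>t\<in>block N l. \<rho> t)" for l
    using avg[of l] \<rho> by (simp add: b_def max_def sum_nonneg)
  have "(\<Sum>t\<in>block N 0. \<rho> t) \<le> (\<Sum>t\<in>block N 0. 1)" by (intro sum_mono \<rho>)
  with bavg[of 0] have "b * real N \<le> 1 * real N" by simp
  with N have b1: "b \<le> 1" by (subst (asm) mult_le_cancel_right) simp
  have fin: "- (real N * total_variation \<theta>) \<le> (\<Sum>t<L * N. \<theta> t * (\<rho> t - b))" for L
  proof -
    have "(\<Sum>t<L * N. \<bar>\<theta> (Suc t) - \<theta> t\<bar>) \<le> total_variation \<theta>"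
      unfolding total_variation_def by (rule sum_le_suminf[OF sd]) auto
    then have "- (real N * total_variation \<theta>) \<le> - (real N * (\<Sum>t<L * N. \<bar>\<theta> (Suc t) - \<theta> t\<bar>))"
      by (simp add: mult_left_mono)
    also have "\<dots> \<le> (\<Sum>t<L * N. \<theta> t * (\<rho> t - b))"
    proof (rule evaluation_block_sum_ge)
      show "\<bar>\<rho> t - b\<bar> \<le> 1" for t
        using \<rho>[of t] b1 max.cobounded1[of 0 c] unfolding b_def by linarith
      show "0 \<le> (\<Sum>t\<in>block N l. \<rho> t - b)" for l using bavg[of l] by (simp add: sum_subtractf mult.commute)
    qed (rule \<theta>0)
    finally show ?thesis .
  qed
  have "(\<lambda>t. \<theta> t * \<rho> t - \<theta> t * b) sums ((\<Sum>t. \<theta> t * \<rho> t) - 1 * b)"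
    by (intro sums_diff summable_sums s\<rho> sums_mult2 \<theta>1)
  then have "(\<lambda>n. \<Sum>t<n. \<theta> t * (\<rho> t - b)) \<longlonglongrightarrow> (\<Sum>t. \<theta> t * \<rho> t) - b"
    by (simp add: sums_def right_diff_distrib)
  \<comment> \<open>Only whole numbers of blocks are controlled; since the series converges, these
    horizons determine its limit.\<close>
  then have "(\<lambda>L. \<Sum>t<L * N. \<theta> t * (\<rho> t - b)) \<longlonglongrightarrow> (\<Sum>t. \<theta> t * \<rho> t) - b"
    using LIMSEQ_subseq_LIMSEQ[of _ _ "\<lambda>L. L * N"] N by (auto simp: strict_mono_def o_def)
  then have "- (real N * total_variation \<theta>) \<le> (\<Sum>t. \<theta> t * \<rho> t) - b"
    by (rule LIMSEQ_le_const) (use fin in blast)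
  then show ?thesis by (simp add: b_def)
qed

section \<open>The limit value and block guarantees for both players\<close>

context controlled_chain
begin

text \<open>The Cauchy property compares any two evaluations of small variation; uniform averages
  over the first \<open>Suc N\<close> stages are a concrete sequence of them, and \<open>v\<close>
  is its limit.\<close>

lemma limit_value_exists:
  assumes x0: "\<forall>d k. 0 \<le> x0 d k" and m: "(\<Sum>d\<in>UNIV. mass (x0 d)) = 1"
  obtains v where "\<And>\<epsilon>. \<epsilon> > 0 \<Longrightarrow> \<exists>\<alpha>>0. \<forall>\<theta> n. finite_eval \<theta> n \<and> variation_upto \<theta> n \<le> \<alpha> \<longrightarrow>
    \<bar>(\<Sum>d\<in>UNIV. value_of \<theta> n (x0 d)) - v\<bar> \<le> \<epsilon>"
proof -
  define V where "V \<theta> n = (\<Sum>d\<in>UNIV. value_of \<theta> n (x0 d))" for \<theta> n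
  have C: "\<exists>\<alpha>>0. \<forall>\<theta> n \<eta> m. finite_eval \<theta> n \<and> finite_eval \<eta> m \<and> variation_upto \<theta> n \<le> \<alpha> \<and>
    variation_upto \<eta> m \<le> \<alpha> \<longrightarrow> \<bar>V \<theta> n - V \<eta> m\<bar> \<le> \<epsilon>" if \<epsilon>: "\<epsilon> > 0" for \<epsilon>
  proof -
    obtain \<alpha> where \<alpha>: "\<alpha> > 0" "\<And>\<theta> n \<eta> m x. finite_eval \<theta> n \<Longrightarrow> finite_eval \<eta> m \<Longrightarrow> variation_upto \<theta> n \<le> \<alpha> \<Longrightarrow>
      variation_upto \<eta> m \<le> \<alpha> \<Longrightarrow> \<forall>k. 0 \<le> x k \<Longrightarrow> value_of \<theta> n x \<le> value_of \<eta> m x + \<epsilon> * mass x"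
      using value_uniformly_Cauchy[OF \<epsilon>] by blast
    have "V \<theta> n \<le> V \<eta> m + \<epsilon>" if "finite_eval \<theta> n" "finite_eval \<eta> m" "variation_upto \<theta> n \<le> \<alpha>" "variation_upto \<eta> m \<le> \<alpha>" for \<theta> n \<eta> m
    proof -
      have "V \<theta> n \<le> (\<Sum>d\<in>UNIV. value_of \<eta> m (x0 d) + \<epsilon> * mass (x0 d))"
        unfolding V_def using x0 by (intro sum_mono \<alpha> that) auto
      then show ?thesis by (simp add: V_def sum.distrib m flip: sum_distrib_left)
    qed
    then show ?thesis using \<alpha>(1) by (intro exI[of _ \<alpha>]) (smt (verit, best))
  qed
  define a where "a N = V (block_eval (Suc N) 0) (Suc N)" for N
  have fe: "finite_eval (block_eval (Suc N) 0) (Suc N)" for N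
    using finite_eval_block_eval[of "Suc N" 0] by simp
  have small: "\<exists>M. \<forall>N\<ge>M. variation_upto (block_eval (Suc N) 0) (Suc N) \<le> \<alpha>" if \<alpha>: "\<alpha> > 0" for \<alpha>
  proof -
    obtain M where M: "2 / \<alpha> < real M" using reals_Archimedean2 by blast
    have "variation_upto (block_eval (Suc N) 0) (Suc N) \<le> \<alpha>" if "N \<ge> M" for N
    proof -
      have "2 / \<alpha> < real (Suc N)" using M that by simp
      then have "2 / real (Suc N) \<le> \<alpha>" using \<alpha> by (simp add: field_simps)
      then show ?thesis using variation_block_eval[of "Suc N" 0 "Suc N"] by linarith
    qed
    then show ?thesis by blast
  qed
  have "Cauchy a"
  proof (rule metric_CauchyI)
    fix e :: real assume e: "e > 0"
    obtain \<alpha> where \<alpha>: "\<alpha> > 0" "\<And>\<theta> n \<eta> m. finite_eval \<theta> n \<Longrightarrow> finite_eval \<eta> m \<Longrightarrow> variation_upto \<theta> n \<le> \<alpha> \<Longrightarrow>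
      variation_upto \<eta> m \<le> \<alpha> \<Longrightarrow> \<bar>V \<theta> n - V \<eta> m\<bar> \<le> e / 2" using C[of "e / 2"] e by auto
    obtain M where M: "\<And>N. N \<ge> M \<Longrightarrow> variation_upto (block_eval (Suc N) 0) (Suc N) \<le> \<alpha>"
      using small[OF \<alpha>(1)] by blast
    have "dist (a p) (a q) < e" if "p \<ge> M" "q \<ge> M" for p q
    proof -
      have "\<bar>a p - a q\<bar> \<le> e / 2" unfolding a_def by (intro \<alpha>(2) fe M that)
      then show ?thesis using e by (simp add: dist_real_def)
    qed
    then show "\<exists>M. \<forall>p\<ge>M. \<forall>q\<ge>M. dist (a p) (a q) < e" by blast
  qed
  then obtain v where v: "a \<longlonglongrightarrow> v" using Cauchy_convergent_iff convergent_def by blast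
  show thesis
  proof (rule that[of v])
    fix \<epsilon> :: real assume \<epsilon>: "\<epsilon> > 0"
    obtain \<alpha> where \<alpha>: "\<alpha> > 0" "\<And>\<theta> n \<eta> m. finite_eval \<theta> n \<Longrightarrow> finite_eval \<eta> m \<Longrightarrow> variation_upto \<theta> n \<le> \<alpha> \<Longrightarrow>
      variation_upto \<eta> m \<le> \<alpha> \<Longrightarrow> \<bar>V \<theta> n - V \<eta> m\<bar> \<le> \<epsilon>" using C[OF \<epsilon>] by blast
    obtain M where M: "\<And>N. N \<ge> M \<Longrightarrow> variation_upto (block_eval (Suc N) 0) (Suc N) \<le> \<alpha>"
      using small[OF \<alpha>(1)] by blast
    have "\<bar>V \<theta> n - v\<bar> \<le> \<epsilon>" if "finite_eval \<theta> n" "variation_upto \<theta> n \<le> \<alpha>" for \<theta> n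
    proof (rule LIMSEQ_le_const2)
      show "(\<lambda>N. \<bar>V \<theta> n - a N\<bar>) \<longlonglongrightarrow> \<bar>V \<theta> n - v\<bar>" by (intro tendsto_intros v)
      show "\<exists>N. \<forall>p\<ge>N. \<bar>V \<theta> n - a p\<bar> \<le> \<epsilon>"
        unfolding a_def using \<alpha>(2)[OF that(1) fe that(2) M] by blast
    qed
    then show "\<exists>\<alpha>>0. \<forall>\<theta> n. finite_eval \<theta> n \<and> variation_upto \<theta> n \<le> \<alpha> \<longrightarrow> \<bar>(\<Sum>d\<in>UNIV. value_of \<theta> n (x0 d)) - v\<bar> \<le> \<epsilon>"
      using \<alpha>(1) unfolding V_def by blast
  qed
qed

text \<open>If no flow were good on all of the first \<open>L\<close> blocks, some weights would
  give every flow at most \<open>v - \<epsilon> + \<epsilon> / 4\<close>. They define an evaluation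
  of variation at most \<open>2 / real N\<close>, whose value is at least
  \<open>v - \<epsilon> / 4\<close>: a contradiction.\<close>

lemma controller_guarantee:
  assumes x0: "\<forall>d k. 0 \<le> x0 d k" and m: "(\<Sum>d\<in>UNIV. mass (x0 d)) = 1" and N: "N > 0" and \<epsilon>: "\<epsilon> > 0"
    and lower: "\<And>\<theta> n. finite_eval \<theta> n \<Longrightarrow> variation_upto \<theta> n \<le> 2 / real N \<Longrightarrow>
      v - \<epsilon> / 4 \<le> (\<Sum>d\<in>UNIV. value_of \<theta> n (x0 d))"
  obtains Z where "is_flow x0 Z" "\<And>l. (v - \<epsilon>) * real N \<le> (\<Sum>t\<in>block N l. flow_stage t Z)"
proof -
  have "\<exists>Y. is_flow x0 Y \<and> (\<forall>l<L. v - \<epsilon> \<le> (\<Sum>t\<in>block N l. flow_stage t Y) / real N)" for L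
  proof (rule ccontr)
    assume neg: "\<nexists>Y. is_flow x0 Y \<and> (\<forall>l<L. v - \<epsilon> \<le> (\<Sum>t\<in>block N l. flow_stage t Y) / real N)"
    define u where "u Y l = (\<Sum>t\<in>block N l. flow_stage t Y) / real N" for Y l
    define C where "C = u ` {Y. is_flow x0 Y}"
    have bnd: "\<bar>u Y l\<bar> \<le> 1" if Y: "is_flow x0 Y" for Y l
    proof -
      have "(\<Sum>t\<in>block N l. flow_stage t Y) \<le> (\<Sum>t\<in>block N l. 1)"
        by (intro sum_mono flow_stage_bounds[OF Y x0 m])
      moreover have "0 \<le> (\<Sum>t\<in>block N l. flow_stage t Y)"
        by (intro sum_nonneg flow_stage_bounds[OF Y x0 m])
      ultimately show ?thesis using N by (simp add: u_def)
    qed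
    obtain \<mu> where \<mu>: "\<And>l. l < L \<Longrightarrow> 0 \<le> \<mu> l" "(\<Sum>l<L. \<mu> l) = 1"
      and \<mu>C: "\<And>w. w \<in> C \<Longrightarrow> (\<Sum>l<L. \<mu> l * w l) \<le> v - \<epsilon> + \<epsilon> / 4"
    proof (rule minimax_weights[of "{..<L}" C 1 "v - \<epsilon>" "\<epsilon> / 4"])
      show "\<exists>u''\<in>C. \<forall>l\<in>{..<L}. (1 - h) * w l + h * w' l \<le> u'' l" if "w \<in> C" "w' \<in> C" "0 \<le> h" "h \<le> 1" for w w' h
      proof -
        from that obtain Y Y' where Y: "is_flow x0 Y" "is_flow x0 Y'" and w: "w = u Y" "w' = u Y'" by (auto simp: C_def)
        let ?Z = "\<lambda>a k i. (1 - h) * Y a k i + h * Y' a k i"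
        have "(1 - h) * w l + h * w' l \<le> u ?Z l" for l
        proof -
          have "(1 - h) * w l + h * w' l = (\<Sum>t\<in>block N l. (1 - h) * flow_stage t Y + h * flow_stage t Y') / real N"
            by (simp add: w u_def sum.distrib sum_distrib_left add_divide_distrib)
          also have "\<dots> \<le> u ?Z l"
            unfolding u_def by (intro divide_right_mono sum_mono flow_stage_concave that) auto
          finally show ?thesis .
        qed
        then show ?thesis using is_flow_convex[OF Y that(3,4)] by (auto simp: C_def)
      qed
      show "\<exists>l\<in>{..<L}. w l \<le> v - \<epsilon>" if "w \<in> C" for w
      proof -
        from that obtain Y where Y: "is_flow x0 Y" "w = u Y" by (auto simp: C_def)
        with neg have "\<not> (\<forall>l<L. v - \<epsilon> \<le> u Y l)" unfolding u_def by blast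
        then obtain l where "l < L" "u Y l < v - \<epsilon>" by (auto simp: not_le)
        then show ?thesis using Y by (intro bexI[of _ l]) auto
      qed
      show "C \<noteq> {}" using is_flow_flow_of[OF x0] by (auto simp: C_def)
    qed (use bnd \<epsilon> in \<open>auto simp: C_def\<close>)
    define \<theta> where "\<theta> = (\<lambda>t. \<Sum>l<L. \<mu> l * block_eval N l t)"
    note mix = block_mixture[where L = L and \<mu> = \<mu>, OF N \<mu>, folded \<theta>_def]
    obtain Y where Y: "is_flow x0 Y" "(\<Sum>d\<in>UNIV. value_of \<theta> (L * N) (x0 d)) - \<epsilon> / 4 \<le> (\<Sum>t<L * N. \<theta> t * flow_stage t Y)"
      using flow_value_approx[OF x0, of "\<epsilon> / 4"] \<epsilon> by auto
    have "v - \<epsilon> / 4 \<le> (\<Sum>d\<in>UNIV. value_of \<theta> (L * N) (x0 d))" by (intro lower mix)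
    also have "\<dots> \<le> (\<Sum>t<L * N. \<theta> t * flow_stage t Y) + \<epsilon> / 4" using Y by simp
    also have "(\<Sum>t<L * N. \<theta> t * flow_stage t Y) = (\<Sum>l<L. \<mu> l * u Y l)"
      unfolding u_def \<theta>_def by (rule block_mixture(3)[where L = L and \<mu> = \<mu>, OF N \<mu>])
    also have "\<dots> \<le> v - \<epsilon> + \<epsilon> / 4" by (rule \<mu>C) (use Y in \<open>auto simp: C_def\<close>)
    finally show False using \<epsilon> by simp
  qed
  then obtain Y where Y: "\<And>L. is_flow x0 (Y L)" "\<And>L l. l < L \<Longrightarrow> v - \<epsilon> \<le> (\<Sum>t\<in>block N l. flow_stage t (Y L)) / real N"
    by metis
  show thesis
  proof (rule flow_block_limit[of x0 Y "block N" "(v - \<epsilon>) * real N"])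
    show "finite (block N l) \<and> (v - \<epsilon>) * real N \<le> (\<Sum>t\<in>block N l. flow_stage t (Y n))" if "l < n" for n l
      using Y(2)[OF that] N by (simp add: field_simps)
  qed (use Y x0 m that in auto)
qed

lemma sum_block_histories:
  "(\<Sum>h | \<exists>t\<in>block N l. length h = Suc t. F h) = (\<Sum>t\<in>block N l. \<Sum>h | length h = Suc t. F h)"
  for F :: "'d list \<Rightarrow> real"
proof -
  have eq: "{h::'d list. \<exists>t\<in>block N l. length h = Suc t} = (\<Union>t\<in>block N l. {h. length h = Suc t})" by auto
  show ?thesis unfolding eq by (rule sum.UNION_disjoint) auto
qed

text \<open>Each block is solved separately and the solutions are glued. This is sound because each
  holds against all flows, however earlier blocks may have shaped the actual one.\<close>

lemma opponent_guarantee: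
  assumes x0: "\<forall>d k. 0 \<le> x0 d k" and m: "(\<Sum>d\<in>UNIV. mass (x0 d)) = 1" and N: "N > 0" and \<epsilon>: "\<epsilon> > 0"
    and upper: "\<And>\<theta> n. finite_eval \<theta> n \<Longrightarrow> variation_upto \<theta> n \<le> 2 / real N \<Longrightarrow>
      (\<Sum>d\<in>UNIV. value_of \<theta> n (x0 d)) \<le> v + \<epsilon>"
  obtains T :: "'d list \<Rightarrow> 'j pmf" where "\<And>Y l. is_flow x0 Y \<Longrightarrow>
    (\<Sum>t\<in>block N l. \<Sum>h | length h = Suc t. \<Sum>j\<in>UNIV. pmf (T h) j * flow_load Y h j) \<le> (v + 2 * \<epsilon>) * real N"
proof -
  define good where "good l T \<longleftrightarrow> (\<forall>Y. is_flow x0 Y \<longrightarrow>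
    (\<Sum>t\<in>block N l. \<Sum>h | length h = Suc t. \<Sum>j\<in>UNIV. pmf (T h) j * flow_load Y h j) \<le> (v + 2 * \<epsilon>) * real N)"
    for l and T :: "'d list \<Rightarrow> 'j pmf"
  have "\<exists>T. good l T" for l
  proof -
    define A where "A = {h::'d list. \<exists>t\<in>block N l. length h = Suc t}"
    have "A = (\<Union>t\<in>block N l. {h. length h = Suc t})" by (auto simp: A_def)
    then have fA: "finite A" by simp
    have neA: "h \<noteq> []" if "h \<in> A" for h using that by (auto simp: A_def)
    obtain T :: "'d list \<Rightarrow> 'j pmf" where T: "\<And>u. u \<in> flow_load ` {Y. is_flow x0 Y} \<Longrightarrow>
      (\<Sum>h\<in>A. \<Sum>j\<in>UNIV. pmf (T h) j * u h j) \<le> (v + \<epsilon>) * real N + \<epsilon> * real N"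
    \<comment> \<open>The index set is the set of signal histories of the block. One
      \<open>\<epsilon>\<close> comes from the values, the other from the minimax lemma.\<close>
    proof (rule minimax_separable[of A "flow_load ` {Y. is_flow x0 Y}" 1 "(v + \<epsilon>) * real N" "\<epsilon> * real N"])
      show "\<bar>u h j\<bar> \<le> 1" if "u \<in> flow_load ` {Y. is_flow x0 Y}" "h \<in> A" for u h j
        using that flow_load_bounds[OF _ x0 m neA] by fastforce
      show "\<exists>u''\<in>flow_load ` {Y. is_flow x0 Y}. \<forall>h\<in>A. \<forall>j. (1 - c) * u h j + c * u' h j = u'' h j"
        if "u \<in> flow_load ` {Y. is_flow x0 Y}" "u' \<in> flow_load ` {Y. is_flow x0 Y}" "0 \<le> c" "c \<le> 1" for u u' c
      proof -
        from that obtain Y Y' where Y: "is_flow x0 Y" "is_flow x0 Y'" "u = flow_load Y" "u' = flow_load Y'" by auto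
        show ?thesis using is_flow_convex[OF Y(1,2) that(3,4)]
          by (intro bexI[of _ "flow_load (\<lambda>h k i. (1 - c) * Y h k i + c * Y' h k i)"]) (auto simp: Y flow_load_convex)
      qed
      show "(\<Sum>h\<in>A. Min (range (u h))) \<le> (v + \<epsilon>) * real N" if "u \<in> flow_load ` {Y. is_flow x0 Y}" for u
      proof -
        from that obtain Y where Y: "is_flow x0 Y" "u = flow_load Y" by auto
        have "(\<Sum>t\<in>block N l. flow_stage t Y) / real N = (\<Sum>t<Suc l * N. block_eval N l t * flow_stage t Y)"
          by (rule sum_block_eval[symmetric]) simp
        also have "\<dots> \<le> (\<Sum>d\<in>UNIV. value_of (block_eval N l) (Suc l * N) (x0 d))"
          by (intro flow_value_upper Y x0 finite_eval_block_eval N)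
        also have "\<dots> \<le> v + \<epsilon>"
          by (intro upper finite_eval_block_eval N variation_block_eval)
        finally show ?thesis using N unfolding A_def sum_block_histories Y
          by (simp add: flow_stage_def field_simps)
      qed
    qed (use fA N \<epsilon> is_flow_flow_of[OF x0] in auto)
    show ?thesis
      unfolding good_def
    proof (intro exI[of _ T] allI impI)
      fix Y assume "is_flow x0 Y"
      then have "(\<Sum>h\<in>A. \<Sum>j\<in>UNIV. pmf (T h) j * flow_load Y h j) \<le> (v + \<epsilon>) * real N + \<epsilon> * real N"
        by (intro T) auto
      also have "\<dots> = (v + 2 * \<epsilon>) * real N" by (simp add: algebra_simps)
      finally show "(\<Sum>t\<in>block N l. \<Sum>h | length h = Suc t. \<Sum>j\<in>UNIV. pmf (T h) j * flow_load Y h j) \<le> (v + 2 * \<epsilon>) * real N"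
        unfolding A_def sum_block_histories .
    qed
  qed
  then obtain T where "\<And>l. good l (T l)" by metis
  note T = this[unfolded good_def, rule_format]
  have div: "t div N = l" if "t \<in> block N l" for t l
    using that by (intro div_nat_eqI) (auto simp: block_def algebra_simps)
  show thesis
  \<comment> \<open>A history of length \<open>t + 1\<close> belongs to stage \<open>t\<close>,
    hence the subtraction before locating its block.\<close>
  proof (rule that[of "\<lambda>h. T ((length h - 1) div N) h"])
    fix Y l assume Y: "is_flow x0 Y"
    have "(\<Sum>t\<in>block N l. \<Sum>h | length h = Suc t. \<Sum>j\<in>UNIV. pmf (T ((length h - 1) div N) h) j * flow_load Y h j) =
      (\<Sum>t\<in>block N l. \<Sum>h | length h = Suc t. \<Sum>j\<in>UNIV. pmf (T l h) j * flow_load Y h j)"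
      by (intro sum.cong refl) (auto simp: div)
    then show "(\<Sum>t\<in>block N l. \<Sum>h | length h = Suc t. \<Sum>j\<in>UNIV. pmf (T ((length h - 1) div N) h) j * flow_load Y h j) \<le> (v + 2 * \<epsilon>) * real N"
      using T[OF Y, of l] by simp
  qed
qed

end

subsection \<open>From the game to flows\<close>

lemma expectation_bind_pmf:
  fixes f :: "'b \<Rightarrow> real"
  assumes "finite (set_pmf p)" "\<And>x. x \<in> set_pmf p \<Longrightarrow> finite (set_pmf (F x))"
  shows "measure_pmf.expectation (bind_pmf p F) f =
    measure_pmf.expectation p (\<lambda>x. measure_pmf.expectation (F x) f)"
  by (subst pmf_expectation_bind[where A = "set_pmf p"])
    (auto simp: assms integral_measure_pmf[of "set_pmf p"])

lemma finite_set_play_dist: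
  fixes q :: "'k::finite \<Rightarrow> 'i::finite \<Rightarrow> 'j::finite \<Rightarrow> ('k \<times> 'c::finite \<times> 'd::finite) pmf"
  shows "finite (set_pmf (play_dist q \<pi> \<sigma> \<tau> n))"
  by (induction n) (auto split: prod.splits)

locale informed_controller = controlled_chain Q g
  for Q :: "'k::finite \<Rightarrow> 'i::finite \<Rightarrow> ('k \<times> 'd::finite) pmf"
    and g :: "'k \<Rightarrow> 'i \<Rightarrow> 'j::finite \<Rightarrow> real" +
  fixes q :: "'k \<Rightarrow> 'i \<Rightarrow> 'j \<Rightarrow> ('k \<times> 'c::finite \<times> 'd) pmf"
    and kt :: "'c \<Rightarrow> 'k" and dt :: "'c \<Rightarrow> 'd" and \<pi> :: "('k \<times> 'c \<times> 'd) pmf"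
  assumes marginal: "map_pmf (\<lambda>(k', c, d). (k', d)) (q k i j) = Q k i"
    and informed: "(k', c, d) \<in> set_pmf (q k i j) \<Longrightarrow> kt c = k' \<and> dt c = d"
    and informed_init: "(k', c, d) \<in> set_pmf \<pi> \<Longrightarrow> kt c = k' \<and> dt c = d"
begin

abbreviation play :: "('c, 'i) strat1 \<Rightarrow> ('d, 'j) strat2 \<Rightarrow> nat \<Rightarrow>
    ('k \<times> ('c \<times> 'i) list \<times> ('d \<times> 'j) list \<times> 'c \<times> 'd) pmf" where
  "play \<equiv> play_dist q \<pi>"

definition initial :: "'d \<Rightarrow> 'k \<Rightarrow> real" where
  "initial d k = pmf (map_pmf (\<lambda>(k, c, d). (k, d)) \<pi>) (k, d)"

definition state_law :: "('c, 'i) strat1 \<Rightarrow> ('d, 'j) strat2 \<Rightarrow> nat \<Rightarrow> ('d list \<times> 'k) pmf" where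
  "state_law \<sigma> \<tau> n = map_pmf (\<lambda>(k, hc, hj, c, d). (map fst hj @ [d], k)) (play \<sigma> \<tau> n)"

definition action_law :: "('c, 'i) strat1 \<Rightarrow> ('d, 'j) strat2 \<Rightarrow> nat \<Rightarrow> ('d list \<times> 'k \<times> 'i) pmf" where
  "action_law \<sigma> \<tau> n = bind_pmf (play \<sigma> \<tau> n) (\<lambda>(k, hc, hj, c, d).
     map_pmf (\<lambda>i. (map fst hj @ [d], k, i)) (\<sigma> hc c))"

definition outcome_law :: "('c, 'i) strat1 \<Rightarrow> ('d, 'j) strat2 \<Rightarrow> nat \<Rightarrow> ('k \<times> 'i \<times> 'j) pmf" where
  "outcome_law \<sigma> \<tau> n = bind_pmf (play \<sigma> \<tau> n) (\<lambda>(k, hc, hj, c, d).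
     bind_pmf (\<sigma> hc c) (\<lambda>i. map_pmf (\<lambda>j. (k, i, j)) (\<tau> hj d)))"

definition play_flow :: "('c, 'i) strat1 \<Rightarrow> ('d, 'j) strat2 \<Rightarrow> 'd list \<Rightarrow> 'k \<Rightarrow> 'i \<Rightarrow> real" where
  "play_flow \<sigma> \<tau> h k i = pmf (action_law \<sigma> \<tau> (length h - 1)) (h, k, i)"

section \<open>The law of play is a flow\<close>

lemma initial_nonneg: "\<forall>d k. 0 \<le> initial d k"
  by (simp add: initial_def)

lemma mass_initial: "(\<Sum>d\<in>UNIV. mass (initial d)) = 1"
proof -
  let ?p = "map_pmf (\<lambda>(k, c, d). (k, d)) \<pi>"
  have "(\<Sum>d\<in>UNIV. mass (initial d)) = (\<Sum>z\<in>UNIV. pmf ?p z)"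
    unfolding mass_def initial_def
    by (subst sum.swap) (simp add: sum.cartesian_product flip: UNIV_Times_UNIV)
  then show ?thesis by (simp add: sum_pmf_eq_1)
qed

lemma map_action_law: "map_pmf (\<lambda>(h, k, i). (h, k)) (action_law \<sigma> \<tau> n) = state_law \<sigma> \<tau> n"
  unfolding action_law_def state_law_def map_bind_pmf
  by (subst (2) map_pmf_def) (intro bind_pmf_cong refl, auto simp: pmf.map_comp o_def map_pmf_const split: prod.splits)

lemma state_law_0: "state_law \<sigma> \<tau> 0 = map_pmf (\<lambda>(k, d). ([d], k)) (map_pmf (\<lambda>(k, c, d). (k, d)) \<pi>)"
  by (simp add: state_law_def pmf.map_comp o_def case_prod_unfold)

text \<open>The marginal of \<open>q\<close> ignores \<open>j\<close>, so player 2's draw integrates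
  out. What influence he has through the signals that \<open>\<sigma>\<close> reads is contained in
  \<open>action_law\<close>.\<close>

lemma state_law_Suc:
  "state_law \<sigma> \<tau> (Suc n) =
     bind_pmf (action_law \<sigma> \<tau> n) (\<lambda>(h, k, i). map_pmf (\<lambda>(k', d'). (h @ [d'], k')) (Q k i))"
proof -
  have m: "map_pmf (\<lambda>(k', c', d'). (h @ [d'], k')) (q k i j) = map_pmf (\<lambda>(k', d'). (h @ [d'], k')) (Q k i)" for h k i j
    by (simp add: marginal[symmetric, of k i j] pmf.map_comp o_def case_prod_unfold)
  have "state_law \<sigma> \<tau> (Suc n) = bind_pmf (play \<sigma> \<tau> n) (\<lambda>(k, hc, hj, c, d). bind_pmf (\<sigma> hc c) (\<lambda>i.
      bind_pmf (\<tau> hj d) (\<lambda>j. map_pmf (\<lambda>(k', c', d'). ((map fst hj @ [d]) @ [d'], k')) (q k i j))))"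
    by (simp add: state_law_def map_bind_pmf pmf.map_comp o_def case_prod_unfold)
  also have "\<dots> = bind_pmf (play \<sigma> \<tau> n) (\<lambda>(k, hc, hj, c, d). bind_pmf (\<sigma> hc c) (\<lambda>i.
      map_pmf (\<lambda>(k', d'). ((map fst hj @ [d]) @ [d'], k')) (Q k i)))"
    unfolding m bind_pmf_const ..
  also have "\<dots> = bind_pmf (action_law \<sigma> \<tau> n) (\<lambda>(h, k, i). map_pmf (\<lambda>(k', d'). (h @ [d'], k')) (Q k i))"
    by (simp add: action_law_def bind_assoc_pmf bind_map_pmf case_prod_unfold)
  finally show ?thesis .
qed

lemma play_lengths: "(k, hc, hj, c, d) \<in> set_pmf (play \<sigma> \<tau> n) \<Longrightarrow> length hj = n"
  by (induction n arbitrary: k hc hj c d) (auto split: prod.splits)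

lemma length_action_law: "(h, k, i) \<in> set_pmf (action_law \<sigma> \<tau> n) \<Longrightarrow> length h = Suc n"
proof -
  assume "(h, k, i) \<in> set_pmf (action_law \<sigma> \<tau> n)"
  then obtain hc hj c d where z: "(k, hc, hj, c, d) \<in> set_pmf (play \<sigma> \<tau> n)" and h: "h = map fst hj @ [d]"
    by (auto simp: action_law_def)
  show ?thesis using play_lengths[OF z] h by simp
qed

lemma sum_play_flow: "(\<Sum>i\<in>UNIV. play_flow \<sigma> \<tau> h k i) = pmf (state_law \<sigma> \<tau> (length h - 1)) (h, k)"
proof -
  have "(\<lambda>(h, k, i::'i). (h, k)) -` {(h, k)} = (\<lambda>i. (h, k, i)) ` UNIV" by (auto simp: image_iff)
  then have "pmf (state_law \<sigma> \<tau> (length h - 1)) (h, k) =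
      measure_pmf.prob (action_law \<sigma> \<tau> (length h - 1)) ((\<lambda>i. (h, k, i)) ` UNIV)"
    unfolding map_action_law[symmetric] pmf_map by simp
  also have "\<dots> = (\<Sum>i\<in>UNIV. play_flow \<sigma> \<tau> h k i)"
    by (subst measure_measure_pmf_finite) (auto simp: sum.reindex inj_on_def play_flow_def)
  finally show ?thesis ..
qed

text \<open>Both strategies are arbitrary: correlation between the players through \<open>c\<close>
  affects only which flow occurs, because \<open>state_law_Suc\<close> is already the balance
  equation.\<close>

lemma is_flow_play_flow: "is_flow initial (play_flow \<sigma> \<tau>)"
  unfolding is_flow_def sum_play_flow
proof (intro conjI allI impI)
  show "0 \<le> play_flow \<sigma> \<tau> h k i" for h k i by (simp add: play_flow_def)
next
  fix d k
  have "inj (\<lambda>(k::'k, d::'d). ([d], k))" by (auto simp: inj_on_def)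
  from pmf_map_inj'[OF this, of _ "(k, d)"] show "pmf (state_law \<sigma> \<tau> (length [d] - 1)) ([d], k) = initial d k"
    by (simp add: state_law_0 initial_def)
next
  fix h :: "'d list" and d k assume h: "h \<noteq> []"
  define n where "n = length h - 1"
  have n: "length (h @ [d]) - 1 = Suc n" using h by (simp add: n_def)
  \<comment> \<open>Appending a signal determines the prefix, so exactly one earlier history
    contributes.\<close>
  have p: "pmf (map_pmf (\<lambda>(k', d'). (h' @ [d'], k')) P) (h @ [d], k) = (if h' = h then pmf P (k, d) else 0)"
    for h' and P :: "('k \<times> 'd) pmf"
  proof (cases "h' = h")
    case True
    have "inj (\<lambda>(k'::'k, d'::'d). (h @ [d'], k'))" by (auto simp: inj_on_def)
    from pmf_map_inj'[OF this, of P "(k, d)"] True show ?thesis by simp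
  next
    case False
    then show ?thesis by (auto simp: pmf_eq_0_set_pmf)
  qed
  have "pmf (state_law \<sigma> \<tau> (Suc n)) (h @ [d], k) =
      measure_pmf.expectation (action_law \<sigma> \<tau> n) (\<lambda>(h', k0, i0). if h' = h then pmf (Q k0 i0) (k, d) else 0)"
    unfolding state_law_Suc pmf_bind by (intro arg_cong2[where f = lebesgue_integral] refl ext) (auto simp: p)
  also have "\<dots> = (\<Sum>z\<in>{h} \<times> UNIV \<times> UNIV. pmf (action_law \<sigma> \<tau> n) z *\<^sub>R
      (case z of (h', k0, i0) \<Rightarrow> if h' = h then pmf (Q k0 i0) (k, d) else 0))"
    by (rule integral_measure_pmf) (auto split: if_splits)
  also have "\<dots> = (\<Sum>k0\<in>UNIV. \<Sum>i0\<in>UNIV. play_flow \<sigma> \<tau> h k0 i0 * pmf (Q k0 i0) (k, d))"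
    unfolding sum.cartesian_product' by (simp add: play_flow_def n_def)
  finally show "pmf (state_law \<sigma> \<tau> (length (h @ [d]) - 1)) (h @ [d], k) =
      (\<Sum>k0\<in>UNIV. \<Sum>i0\<in>UNIV. play_flow \<sigma> \<tau> h k0 i0 * pmf (Q k0 i0) (k, d))" by (simp only: n)
qed

lemma stage_payoff_outcome:
  "stage_payoff q g \<pi> \<sigma> \<tau> n = measure_pmf.expectation (outcome_law \<sigma> \<tau> n) (\<lambda>(k, i, j). g k i j)"
  unfolding stage_payoff_def outcome_law_def
  by (subst expectation_bind_pmf[OF finite_set_play_dist])
    (auto intro!: arg_cong2[where f = lebesgue_integral] ext simp: expectation_bind_pmf)

text \<open>A reply independent of state and action given the signals makes the payoff bilinear in
  reply and flow. Replies ignoring own actions have this form, and so do arbitrary ones, once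
  averaged, against a Markov strategy.\<close>

lemma expectation_open_loop:
  "measure_pmf.expectation (bind_pmf (action_law \<sigma> \<tau> n) (\<lambda>(h, k, i). map_pmf (\<lambda>j. (k, i, j)) (T h)))
     (\<lambda>(k, i, j). g k i j) =
   (\<Sum>h | length h = Suc n. \<Sum>j\<in>UNIV. pmf (T h) j * flow_load (play_flow \<sigma> \<tau>) h j)"
proof -
  let ?A = "{h::'d list. length h = Suc n} \<times> (UNIV::'k set) \<times> (UNIV::'i set)"
  have "measure_pmf.expectation (bind_pmf (action_law \<sigma> \<tau> n) (\<lambda>(h, k, i). map_pmf (\<lambda>j. (k, i, j)) (T h)))
     (\<lambda>(k, i, j). g k i j) = (\<Sum>z\<in>?A. pmf (action_law \<sigma> \<tau> n) z *\<^sub>R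
       measure_pmf.expectation (case z of (h, k, i) \<Rightarrow> map_pmf (\<lambda>j. (k, i, j)) (T h)) (\<lambda>(k, i, j). g k i j))"
    by (rule pmf_expectation_bind) (auto dest: length_action_law)
  also have "\<dots> = (\<Sum>h | length h = Suc n. \<Sum>k\<in>UNIV. \<Sum>i\<in>UNIV. play_flow \<sigma> \<tau> h k i * (\<Sum>j\<in>UNIV. pmf (T h) j * g k i j))"
    unfolding sum.cartesian_product'
    by (intro sum.cong refl) (auto simp: play_flow_def integral_measure_pmf[of UNIV])
  also have "\<dots> = (\<Sum>h | length h = Suc n. \<Sum>j\<in>UNIV. pmf (T h) j * flow_load (play_flow \<sigma> \<tau>) h j)"
  proof (rule sum.cong[OF refl])
    fix h
    have "(\<Sum>k\<in>UNIV. \<Sum>i\<in>UNIV. play_flow \<sigma> \<tau> h k i * (\<Sum>j\<in>UNIV. pmf (T h) j * g k i j)) =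
        (\<Sum>k\<in>UNIV. \<Sum>i\<in>UNIV. \<Sum>j\<in>UNIV. pmf (T h) j * (play_flow \<sigma> \<tau> h k i * g k i j))"
      by (simp add: sum_distrib_left mult_ac)
    also have "\<dots> = (\<Sum>k\<in>UNIV. \<Sum>j\<in>UNIV. \<Sum>i\<in>UNIV. pmf (T h) j * (play_flow \<sigma> \<tau> h k i * g k i j))"
      by (rule sum.cong[OF refl]) (rule sum.swap)
    also have "\<dots> = (\<Sum>j\<in>UNIV. \<Sum>k\<in>UNIV. \<Sum>i\<in>UNIV. pmf (T h) j * (play_flow \<sigma> \<tau> h k i * g k i j))"
      by (rule sum.swap)
    finally show "(\<Sum>k\<in>UNIV. \<Sum>i\<in>UNIV. play_flow \<sigma> \<tau> h k i * (\<Sum>j\<in>UNIV. pmf (T h) j * g k i j)) =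
        (\<Sum>j\<in>UNIV. pmf (T h) j * flow_load (play_flow \<sigma> \<tau>) h j)"
      by (simp add: flow_load_def sum_distrib_left)
  qed
  finally show ?thesis .
qed

section \<open>Strategies based on player 2's signals, and on the state for player 1\<close>

definition open_loop :: "('d list \<Rightarrow> 'j pmf) \<Rightarrow> ('d, 'j) strat2" where
  "open_loop T hj d = T (map fst hj @ [d])"

lemma stage_payoff_open_loop:
  "stage_payoff q g \<pi> \<sigma> (open_loop T) n =
   (\<Sum>h | length h = Suc n. \<Sum>j\<in>UNIV. pmf (T h) j * flow_load (play_flow \<sigma> (open_loop T)) h j)"
proof -
  have "outcome_law \<sigma> (open_loop T) n =
      bind_pmf (action_law \<sigma> (open_loop T) n) (\<lambda>(h, k, i). map_pmf (\<lambda>j. (k, i, j)) (T h))"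
    unfolding outcome_law_def action_law_def open_loop_def
    by (simp add: bind_assoc_pmf bind_map_pmf case_prod_unfold)
  then show ?thesis by (simp add: stage_payoff_outcome expectation_open_loop)
qed

text \<open>The information hypothesis at work: \<open>kt\<close> and \<open>dt\<close> recover the
  state and player 2's signals, so \<open>S\<close> is playable. Whatever else \<open>c\<close>
  reveals, such as past actions of player 2, is ignored.\<close>

definition markov :: "('d list \<Rightarrow> 'k \<Rightarrow> 'i pmf) \<Rightarrow> ('c, 'i) strat1" where
  "markov S hc c = S (map (dt \<circ> fst) hc @ [dt c]) (kt c)"

lemma play_informed:
  "(k, hc, hj, c, d) \<in> set_pmf (play \<sigma> \<tau> n) \<Longrightarrow> kt c = k \<and> dt c = d \<and> map (dt \<circ> fst) hc = map fst hj"
  by (induction n arbitrary: k hc hj c d) (auto split: prod.splits dest: informed informed_init)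

lemma markov_play:
  "(k, hc, hj, c, d) \<in> set_pmf (play \<sigma> \<tau> n) \<Longrightarrow> markov S hc c = S (map fst hj @ [d]) k"
  using play_informed by (fastforce simp: markov_def)

lemma action_law_markov:
  "action_law (markov S) \<tau> n = bind_pmf (state_law (markov S) \<tau> n) (\<lambda>(h, k). map_pmf (\<lambda>i. (h, k, i)) (S h k))"
  unfolding action_law_def state_law_def bind_map_pmf
  by (intro bind_pmf_cong refl) (auto simp: markov_play)

text \<open>The conditional law of the action is \<open>S\<close> whatever \<open>\<tau>\<close>
  does, and this determines the flow: player 2 has lost his influence on it.\<close>

lemma play_flow_markov:
  assumes "h \<noteq> []" shows "play_flow (markov S) \<tau> h = flow_of initial S h"
proof (rule flow_determined[OF is_flow_play_flow _ assms])
  fix h :: "'d list" and k i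
  let ?n = "length h - 1"
  have "play_flow (markov S) \<tau> h k i = measure_pmf.expectation (state_law (markov S) \<tau> ?n)
      (\<lambda>z. if z = (h, k) then pmf (S h k) i else 0)"
    unfolding play_flow_def action_law_markov pmf_bind
  proof (intro arg_cong2[where f = lebesgue_integral] refl ext)
    fix z :: "'d list \<times> 'k"
    show "pmf (case z of (h, k) \<Rightarrow> map_pmf (\<lambda>i. (h, k, i)) (S h k)) (h, k, i) = (if z = (h, k) then pmf (S h k) i else 0)"
    proof (cases "z = (h, k)")
      case True
      have "inj (\<lambda>i::'i. (h, k, i))" by (auto simp: inj_on_def)
      from pmf_map_inj'[OF this, of "S h k" i] True show ?thesis by simp
    next
      case False
      then show ?thesis by (cases z) (auto simp: pmf_eq_0_set_pmf)
    qed
  qed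
  also have "\<dots> = pmf (state_law (markov S) \<tau> ?n) (h, k) * pmf (S h k) i"
    by (subst integral_measure_pmf[of "{(h, k)}"]) (auto split: if_splits)
  finally show "play_flow (markov S) \<tau> h k i = (\<Sum>i\<in>UNIV. play_flow (markov S) \<tau> h k i) * pmf (S h k) i"
    by (simp add: sum_play_flow)
qed

text \<open>Against a Markov strategy the past actions of player 2 carry no information on the state:
  given the signals, they are generated by \<open>response_law\<close>, independently of the state.\<close>

definition response_law :: "('d, 'j) strat2 \<Rightarrow> 'd list \<Rightarrow> ('d \<times> 'j) list pmf" where
  "response_law \<tau> h = foldl (\<lambda>P d. bind_pmf P (\<lambda>hj. map_pmf (\<lambda>j. hj @ [(d, j)]) (\<tau> hj d))) (return_pmf []) h"

lemma response_law_snoc: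
  "response_law \<tau> (h @ [d]) = bind_pmf (response_law \<tau> h) (\<lambda>hj. map_pmf (\<lambda>j. hj @ [(d, j)]) (\<tau> hj d))"
  by (simp add: response_law_def)

lemma response_law_signals: "hj \<in> set_pmf (response_law \<tau> h) \<Longrightarrow> map fst hj = h"
  by (induction h arbitrary: hj rule: rev_induct) (auto simp: response_law_snoc, simp add: response_law_def)

lemma state_law_nonempty: "(h, k) \<in> set_pmf (state_law \<sigma> \<tau> n) \<Longrightarrow> h \<noteq> []"
  by (auto simp: state_law_def)

text \<open>\<open>S\<close> reads only signals and state, and the next state and signal do not
  depend on \<open>j\<close>, so in the induction the draws of player 2's action and of the
  transition commute. The last signal is not yet answered, hence \<open>butlast\<close>.\<close>

lemma play_markov_factor:
  "map_pmf (\<lambda>(k, hc, hj, c, d). (k, hj, d)) (play (markov S) \<tau> n) =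
   bind_pmf (state_law (markov S) \<tau> n) (\<lambda>(h, k). map_pmf (\<lambda>hj. (k, hj, last h)) (response_law \<tau> (butlast h)))"
proof (induction n)
  case 0
  show ?case
    by (simp add: state_law_0 bind_map_pmf pmf.map_comp o_def case_prod_unfold response_law_def map_pmf_def bind_return_pmf bind_assoc_pmf)
next
  case (Suc n)
  let ?next = "\<lambda>k i hj d. \<lambda>j. map_pmf (\<lambda>(k', d'). (k', hj @ [(d, j)], d')) (Q k i)"
  have m: "map_pmf (\<lambda>(k', c', d'). (k', hj, d')) (q k i j) = map_pmf (\<lambda>(k', d'). (k', hj, d')) (Q k i)"
    for k i j and hj :: "('d \<times> 'j) list"
    by (simp add: marginal[symmetric, of k i j] pmf.map_comp o_def case_prod_unfold)
  have "map_pmf (\<lambda>(k, hc, hj, c, d). (k, hj, d)) (play (markov S) \<tau> (Suc n)) =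
      bind_pmf (play (markov S) \<tau> n) (\<lambda>(k, hc, hj, c, d).
        bind_pmf (markov S hc c) (\<lambda>i. bind_pmf (\<tau> hj d) (?next k i hj d)))"
  proof -
    have "map_pmf (\<lambda>(k, hc, hj, c, d). (k, hj, d)) (play (markov S) \<tau> (Suc n)) =
      bind_pmf (play (markov S) \<tau> n) (\<lambda>(k, hc, hj, c, d). bind_pmf (markov S hc c) (\<lambda>i.
        bind_pmf (\<tau> hj d) (\<lambda>j. map_pmf (\<lambda>(k', c', d'). (k', hj @ [(d, j)], d')) (q k i j))))"
      by (simp add: map_bind_pmf pmf.map_comp o_def case_prod_unfold)
    then show ?thesis unfolding m .
  qed
  also have "\<dots> = bind_pmf (play (markov S) \<tau> n) (\<lambda>(k, hc, hj, c, d).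
        bind_pmf (S (map fst hj @ [d]) k) (\<lambda>i. bind_pmf (\<tau> hj d) (?next k i hj d)))"
    by (intro bind_pmf_cong refl) (auto simp: markov_play)
  also have "\<dots> = bind_pmf (map_pmf (\<lambda>(k, hc, hj, c, d). (k, hj, d)) (play (markov S) \<tau> n)) (\<lambda>(k, hj, d).
        bind_pmf (S (map fst hj @ [d]) k) (\<lambda>i. bind_pmf (\<tau> hj d) (?next k i hj d)))"
    by (simp add: bind_map_pmf case_prod_unfold)
  also have "\<dots> = bind_pmf (state_law (markov S) \<tau> n) (\<lambda>(h, k). bind_pmf (response_law \<tau> (butlast h)) (\<lambda>hj.
        bind_pmf (S (map fst hj @ [last h]) k) (\<lambda>i. bind_pmf (\<tau> hj (last h)) (?next k i hj (last h)))))"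
    unfolding Suc.IH by (simp add: bind_assoc_pmf bind_map_pmf case_prod_unfold)
  also have "\<dots> = bind_pmf (state_law (markov S) \<tau> n) (\<lambda>(h, k). bind_pmf (S h k) (\<lambda>i.
        bind_pmf (Q k i) (\<lambda>(k', d'). map_pmf (\<lambda>hj. (k', hj, d')) (response_law \<tau> h))))"
  proof (intro bind_pmf_cong refl, clarify)
    fix h k assume "(h, k) \<in> set_pmf (state_law (markov S) \<tau> n)"
    then have h: "h = butlast h @ [last h]" using state_law_nonempty by fastforce
    have "bind_pmf (response_law \<tau> (butlast h)) (\<lambda>hj.
        bind_pmf (S (map fst hj @ [last h]) k) (\<lambda>i. bind_pmf (\<tau> hj (last h)) (?next k i hj (last h)))) =
      bind_pmf (response_law \<tau> (butlast h)) (\<lambda>hj.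
        bind_pmf (S h k) (\<lambda>i. bind_pmf (\<tau> hj (last h)) (?next k i hj (last h))))"
      by (intro bind_pmf_cong refl) (use response_law_signals h in metis)
    also have "\<dots> = bind_pmf (S h k) (\<lambda>i. bind_pmf (response_law \<tau> (butlast h)) (\<lambda>hj.
        bind_pmf (\<tau> hj (last h)) (?next k i hj (last h))))"
      by (rule bind_commute_pmf)
    also have "\<dots> = bind_pmf (S h k) (\<lambda>i. bind_pmf (response_law \<tau> h) (\<lambda>hj. map_pmf (\<lambda>(k', d'). (k', hj, d')) (Q k i)))"
      by (subst (3) h) (simp add: response_law_snoc bind_assoc_pmf bind_map_pmf)
    also have "\<dots> = bind_pmf (S h k) (\<lambda>i. bind_pmf (Q k i) (\<lambda>(k', d'). map_pmf (\<lambda>hj. (k', hj, d')) (response_law \<tau> h)))"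
      unfolding map_pmf_def case_prod_unfold by (subst bind_commute_pmf) (rule refl)
    finally show "bind_pmf (response_law \<tau> (butlast h)) (\<lambda>hj.
        bind_pmf (S (map fst hj @ [last h]) k) (\<lambda>i. bind_pmf (\<tau> hj (last h)) (?next k i hj (last h)))) =
      bind_pmf (S h k) (\<lambda>i. bind_pmf (Q k i) (\<lambda>(k', d'). map_pmf (\<lambda>hj. (k', hj, d')) (response_law \<tau> h)))" .
  qed
  also have "\<dots> = bind_pmf (state_law (markov S) \<tau> (Suc n))
      (\<lambda>(h, k). map_pmf (\<lambda>hj. (k, hj, last h)) (response_law \<tau> (butlast h)))"
    unfolding state_law_Suc action_law_markov
    by (simp add: bind_assoc_pmf bind_map_pmf case_prod_unfold)
  finally show ?case .
qed

lemma stage_payoff_markov: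
  "\<exists>T. \<forall>n. stage_payoff q g \<pi> (markov S) \<tau> n =
     (\<Sum>h | length h = Suc n. \<Sum>j\<in>UNIV. pmf (T h) j * flow_load (flow_of initial S) h j)"
proof (intro exI allI)
  fix n
  \<comment> \<open>Averaging \<open>\<tau>\<close> over player 2's own past actions leaves a reply
    to the signals alone; it does not depend on \<open>n\<close>.\<close>
  define T where "T h = bind_pmf (response_law \<tau> (butlast h)) (\<lambda>hj. \<tau> hj (last h))" for h
  have "outcome_law (markov S) \<tau> n = bind_pmf (map_pmf (\<lambda>(k, hc, hj, c, d). (k, hj, d)) (play (markov S) \<tau> n))
      (\<lambda>(k, hj, d). bind_pmf (S (map fst hj @ [d]) k) (\<lambda>i. map_pmf (\<lambda>j. (k, i, j)) (\<tau> hj d)))"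
    unfolding outcome_law_def bind_map_pmf by (intro bind_pmf_cong refl) (auto simp: markov_play)
  also have "\<dots> = bind_pmf (state_law (markov S) \<tau> n) (\<lambda>(h, k). bind_pmf (response_law \<tau> (butlast h)) (\<lambda>hj.
      bind_pmf (S (map fst hj @ [last h]) k) (\<lambda>i. map_pmf (\<lambda>j. (k, i, j)) (\<tau> hj (last h)))))"
    unfolding play_markov_factor by (simp add: bind_assoc_pmf bind_map_pmf case_prod_unfold)
  also have "\<dots> = bind_pmf (state_law (markov S) \<tau> n) (\<lambda>(h, k). bind_pmf (S h k) (\<lambda>i. map_pmf (\<lambda>j. (k, i, j)) (T h)))"
  proof (intro bind_pmf_cong refl, clarify)
    fix h k assume "(h, k) \<in> set_pmf (state_law (markov S) \<tau> n)"
    then have h: "h = butlast h @ [last h]" using state_law_nonempty by fastforce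
    have "bind_pmf (response_law \<tau> (butlast h)) (\<lambda>hj.
        bind_pmf (S (map fst hj @ [last h]) k) (\<lambda>i. map_pmf (\<lambda>j. (k, i, j)) (\<tau> hj (last h)))) =
      bind_pmf (response_law \<tau> (butlast h)) (\<lambda>hj. bind_pmf (S h k) (\<lambda>i. map_pmf (\<lambda>j. (k, i, j)) (\<tau> hj (last h))))"
      by (intro bind_pmf_cong refl) (use response_law_signals h in metis)
    also have "\<dots> = bind_pmf (S h k) (\<lambda>i. map_pmf (\<lambda>j. (k, i, j)) (T h))"
      unfolding T_def map_bind_pmf by (rule bind_commute_pmf)
    finally show "bind_pmf (response_law \<tau> (butlast h)) (\<lambda>hj.
        bind_pmf (S (map fst hj @ [last h]) k) (\<lambda>i. map_pmf (\<lambda>j. (k, i, j)) (\<tau> hj (last h)))) =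
      bind_pmf (S h k) (\<lambda>i. map_pmf (\<lambda>j. (k, i, j)) (T h))" .
  qed
  also have "\<dots> = bind_pmf (action_law (markov S) \<tau> n) (\<lambda>(h, k, i). map_pmf (\<lambda>j. (k, i, j)) (T h))"
    unfolding action_law_markov by (simp add: bind_assoc_pmf bind_map_pmf case_prod_unfold)
  finally have "stage_payoff q g \<pi> (markov S) \<tau> n =
      (\<Sum>h | length h = Suc n. \<Sum>j\<in>UNIV. pmf (T h) j * flow_load (play_flow (markov S) \<tau>) h j)"
    by (simp add: stage_payoff_outcome expectation_open_loop)
  also have "\<dots> = (\<Sum>h | length h = Suc n. \<Sum>j\<in>UNIV. pmf (T h) j * flow_load (flow_of initial S) h j)"
    unfolding flow_load_def by (intro sum.cong refl) (subst play_flow_markov; auto)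
  finally show "stage_payoff q g \<pi> (markov S) \<tau> n =
      (\<Sum>h | length h = Suc n. \<Sum>j\<in>UNIV. pmf (bind_pmf (response_law \<tau> (butlast h)) (\<lambda>hj. \<tau> hj (last h))) j * flow_load (flow_of initial S) h j)"
    unfolding T_def .
qed

lemma stage_payoff_markov_ge: "flow_stage n (flow_of initial S) \<le> stage_payoff q g \<pi> (markov S) \<tau> n"
proof -
  obtain T where T: "\<And>n. stage_payoff q g \<pi> (markov S) \<tau> n =
     (\<Sum>h | length h = Suc n. \<Sum>j\<in>UNIV. pmf (T h) j * flow_load (flow_of initial S) h j)"
    using stage_payoff_markov by blast
  show ?thesis
    unfolding T flow_stage_def
  proof (rule sum_mono)
    fix h
    have "Min (range (flow_load (flow_of initial S) h)) =
        (\<Sum>j\<in>UNIV. pmf (T h) j * Min (range (flow_load (flow_of initial S) h)))"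
      by (simp add: sum_pmf_eq_1 flip: sum_distrib_right)
    also have "\<dots> \<le> (\<Sum>j\<in>UNIV. pmf (T h) j * flow_load (flow_of initial S) h j)"
      by (intro sum_mono mult_left_mono) auto
    finally show "Min (range (flow_load (flow_of initial S) h)) \<le>
        (\<Sum>j\<in>UNIV. pmf (T h) j * flow_load (flow_of initial S) h j)" .
  qed
qed

section \<open>Bounds for arbitrary evaluations and the uniform value\<close>

lemma stage_payoff_bounds: "0 \<le> stage_payoff q g \<pi> \<sigma> \<tau> n" "stage_payoff q g \<pi> \<sigma> \<tau> n \<le> 1"
proof -
  have eq: "stage_payoff q g \<pi> \<sigma> \<tau> n = (\<Sum>z\<in>UNIV. pmf (outcome_law \<sigma> \<tau> n) z * (case z of (k, i, j) \<Rightarrow> g k i j))"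
    unfolding stage_payoff_outcome by (subst integral_measure_pmf[of UNIV]) auto
  show "0 \<le> stage_payoff q g \<pi> \<sigma> \<tau> n"
    unfolding eq using g_range by (intro sum_nonneg mult_nonneg_nonneg) (auto split: prod.splits)
  have "stage_payoff q g \<pi> \<sigma> \<tau> n \<le> (\<Sum>z\<in>UNIV. pmf (outcome_law \<sigma> \<tau> n) z * 1)"
    unfolding eq using g_range by (intro sum_mono mult_left_mono) (auto split: prod.splits)
  then show "stage_payoff q g \<pi> \<sigma> \<tau> n \<le> 1" by (simp add: sum_pmf_eq_1)
qed

lemma summable_gamma:
  assumes "is_evaluation \<theta>"
  shows "summable (\<lambda>t. \<theta> t * stage_payoff q g \<pi> \<sigma> \<tau> t)"
proof (rule summable_comparison_test'[of \<theta> 0])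
  show "summable \<theta>" using assms by (auto simp: is_evaluation_def sums_iff)
  show "norm (\<theta> t * stage_payoff q g \<pi> \<sigma> \<tau> t) \<le> \<theta> t" for t
    using assms stage_payoff_bounds[of \<sigma> \<tau> t] by (auto simp: is_evaluation_def abs_mult mult_left_le)
qed

lemma gamma_bounds:
  assumes "is_evaluation \<theta>"
  shows "0 \<le> gamma q g \<theta> \<pi> \<sigma> \<tau>" "gamma q g \<theta> \<pi> \<sigma> \<tau> \<le> 1"
proof -
  have \<theta>: "\<And>t. 0 \<le> \<theta> t" "summable \<theta>" "suminf \<theta> = 1" using assms by (auto simp: is_evaluation_def sums_iff)
  show "0 \<le> gamma q g \<theta> \<pi> \<sigma> \<tau>"
    unfolding gamma_def using \<theta> stage_payoff_bounds by (intro suminf_nonneg summable_gamma assms) auto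
  have "gamma q g \<theta> \<pi> \<sigma> \<tau> \<le> suminf \<theta>"
    unfolding gamma_def using \<theta> stage_payoff_bounds
    by (intro suminf_le summable_gamma assms) (auto simp: mult_left_le)
  then show "gamma q g \<theta> \<pi> \<sigma> \<tau> \<le> 1" by (simp add: \<theta>)
qed

text \<open>Guarantees on both sides enclose the sup-inf directly, without a minimax theorem for the
  infinite game.\<close>

lemma val_theta_between:
  assumes \<theta>: "is_evaluation \<theta>"
    and lo: "\<And>\<tau>. a \<le> gamma q g \<theta> \<pi> \<sigma>s \<tau>" and hi: "\<And>\<sigma>. gamma q g \<theta> \<pi> \<sigma> \<tau>s \<le> b"
  shows "a \<le> val_theta q g \<theta> \<pi>" "val_theta q g \<theta> \<pi> \<le> b"
proof -
  have bb: "bdd_below (range (gamma q g \<theta> \<pi> \<sigma>))" for \<sigma>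
    using gamma_bounds(1)[OF \<theta>] by (auto intro!: bdd_belowI2)
  have up: "(INF \<tau>. gamma q g \<theta> \<pi> \<sigma> \<tau>) \<le> b" for \<sigma>
    by (rule cINF_lower2[where x = \<tau>s]) (auto intro: bb hi)
  have "a \<le> (INF \<tau>. gamma q g \<theta> \<pi> \<sigma>s \<tau>)" by (rule cINF_greatest) (auto intro: lo)
  also have "\<dots> \<le> val_theta q g \<theta> \<pi>"
    unfolding val_theta_def by (rule cSUP_upper) (auto intro!: bdd_aboveI2 up)
  finally show "a \<le> val_theta q g \<theta> \<pi>" .
  show "val_theta q g \<theta> \<pi> \<le> b" unfolding val_theta_def by (rule cSUP_least) (auto intro: up)
qed

lemma gamma_ge_of_blocks:
  assumes "is_evaluation \<theta>" "N > 0" "\<And>l. c * real N \<le> (\<Sum>t\<in>block N l. stage_payoff q g \<pi> \<sigma> \<tau> t)"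
  shows "c - real N * total_variation \<theta> \<le> gamma q g \<theta> \<pi> \<sigma> \<tau>"
  unfolding gamma_def by (intro evaluation_block_average assms stage_payoff_bounds)

text \<open>The lower estimate applied to the complementary payoff
  \<open>1 - stage_payoff\<close>.\<close>

lemma gamma_le_of_blocks:
  assumes \<theta>: "is_evaluation \<theta>" and N: "N > 0" and blk: "\<And>l. (\<Sum>t\<in>block N l. stage_payoff q g \<pi> \<sigma> \<tau> t) \<le> c * real N"
  shows "gamma q g \<theta> \<pi> \<sigma> \<tau> \<le> c + real N * total_variation \<theta>"
proof -
  let ?r = "stage_payoff q g \<pi> \<sigma> \<tau>"
  have "(1 - c) - real N * total_variation \<theta> \<le> (\<Sum>t. \<theta> t * (1 - ?r t))"
  proof (rule evaluation_block_average[OF \<theta> _ _ N])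
    show "(1 - c) * real N \<le> (\<Sum>t\<in>block N l. 1 - ?r t)" for l
      using blk[of l] by (simp add: sum_subtractf left_diff_distrib)
  qed (use stage_payoff_bounds in auto)
  also have "(\<Sum>t. \<theta> t * (1 - ?r t)) = 1 - gamma q g \<theta> \<pi> \<sigma> \<tau>"
    using suminf_diff[OF _ summable_gamma[OF \<theta>, of \<sigma> \<tau>], of \<theta>] \<theta>
    by (simp add: gamma_def right_diff_distrib is_evaluation_def sums_iff)
  finally show ?thesis by simp
qed

lemma general_uniform_value:
  "\<exists>v. \<forall>\<epsilon>>0. \<exists>\<alpha>>0. \<exists>\<sigma>s \<tau>s. \<forall>\<theta>.
     is_evaluation \<theta> \<and> total_variation \<theta> \<le> \<alpha> \<longrightarrow>
       \<bar>val_theta q g \<theta> \<pi> - v\<bar> \<le> \<epsilon>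
     \<and> (\<forall>\<tau>. gamma q g \<theta> \<pi> \<sigma>s \<tau> \<ge> v - \<epsilon>)
     \<and> (\<forall>\<sigma>. gamma q g \<theta> \<pi> \<sigma> \<tau>s \<le> v + \<epsilon>)"
proof -
  obtain v where v: "\<And>\<epsilon>. \<epsilon> > 0 \<Longrightarrow> \<exists>\<alpha>>0. \<forall>\<theta> n. finite_eval \<theta> n \<and> variation_upto \<theta> n \<le> \<alpha> \<longrightarrow>
    \<bar>(\<Sum>d\<in>UNIV. value_of \<theta> n (initial d)) - v\<bar> \<le> \<epsilon>"
    by (rule limit_value_exists[OF initial_nonneg mass_initial]) blast
  show ?thesis
  proof (rule exI[of _ v], intro allI impI)
    fix \<epsilon> :: real assume \<epsilon>: "\<epsilon> > 0"
    \<comment> \<open>\<open>\<epsilon> / 8\<close> is a quarter of the loss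
      \<open>\<epsilon> / 2\<close> granted to player 1, and player 2 loses twice that
      eighth.\<close>
    obtain \<beta> where \<beta>: "\<beta> > 0" and near: "\<And>\<theta> n. finite_eval \<theta> n \<Longrightarrow> variation_upto \<theta> n \<le> \<beta> \<Longrightarrow>
      \<bar>(\<Sum>d\<in>UNIV. value_of \<theta> n (initial d)) - v\<bar> \<le> \<epsilon> / 8"
      using v[of "\<epsilon> / 8"] \<epsilon> by auto
    obtain M where M: "2 / \<beta> < real M" using reals_Archimedean2 by blast
    define N where "N = Suc M"
    have N: "N > 0" by (simp add: N_def)
    have "2 / \<beta> < real N" using M by (simp add: N_def)
    then have N\<beta>: "2 / real N \<le> \<beta>" using N \<beta> by (simp add: field_simps)
    obtain Z where Z: "is_flow initial Z" "\<And>l. (v - \<epsilon> / 2) * real N \<le> (\<Sum>t\<in>block N l. flow_stage t Z)"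
    proof (rule controller_guarantee[OF initial_nonneg mass_initial N, of "\<epsilon> / 2" v])
      show "v - \<epsilon> / 2 / 4 \<le> (\<Sum>d\<in>UNIV. value_of \<theta> n (initial d))"
        if "finite_eval \<theta> n" "variation_upto \<theta> n \<le> 2 / real N" for \<theta> n
        using near[OF that(1) order_trans[OF that(2) N\<beta>]] by linarith
    qed (use \<epsilon> in auto)
    obtain S where S: "\<And>h. h \<noteq> [] \<Longrightarrow> Z h = flow_of initial S h"
      by (rule flow_eq_flow_of[OF Z(1)]) blast
    obtain T where T: "\<And>Y l. is_flow initial Y \<Longrightarrow> (\<Sum>t\<in>block N l. \<Sum>h | length h = Suc t.
        \<Sum>j\<in>UNIV. pmf (T h) j * flow_load Y h j) \<le> (v + 2 * (\<epsilon> / 8)) * real N"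
    proof (rule opponent_guarantee[OF initial_nonneg mass_initial N, of "\<epsilon> / 8" v])
      show "(\<Sum>d\<in>UNIV. value_of \<theta> n (initial d)) \<le> v + \<epsilon> / 8"
        if "finite_eval \<theta> n" "variation_upto \<theta> n \<le> 2 / real N" for \<theta> n
        using near[OF that(1) order_trans[OF that(2) N\<beta>]] by linarith
    qed (use \<epsilon> in auto)
    \<comment> \<open>Passing from block averages to \<open>\<theta>\<close> costs \<open>N\<close>
      times its variation, here at most \<open>\<epsilon> / 2\<close>.\<close>
    define \<alpha> where "\<alpha> = \<epsilon> / (2 * real N)"
    have \<alpha>: "\<alpha> > 0" using \<epsilon> N by (simp add: \<alpha>_def)
    have main: "\<bar>val_theta q g \<theta> \<pi> - v\<bar> \<le> \<epsilon> \<and> (\<forall>\<tau>. gamma q g \<theta> \<pi> (markov S) \<tau> \<ge> v - \<epsilon>)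
        \<and> (\<forall>\<sigma>. gamma q g \<theta> \<pi> \<sigma> (open_loop T) \<le> v + \<epsilon>)"
      if \<theta>: "is_evaluation \<theta>" and tv: "total_variation \<theta> \<le> \<alpha>" for \<theta>
    proof -
      have NT: "real N * total_variation \<theta> \<le> \<epsilon> / 2" using tv N by (simp add: \<alpha>_def field_simps)
      have lo: "v - \<epsilon> \<le> gamma q g \<theta> \<pi> (markov S) \<tau>" for \<tau>
      proof -
        have "(v - \<epsilon> / 2) - real N * total_variation \<theta> \<le> gamma q g \<theta> \<pi> (markov S) \<tau>"
        proof (rule gamma_ge_of_blocks[OF \<theta> N])
          fix l
          have "(v - \<epsilon> / 2) * real N \<le> (\<Sum>t\<in>block N l. flow_stage t (flow_of initial S))"
            using Z(2)[of l] flow_stage_cong[OF S] by simp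
          also have "\<dots> \<le> (\<Sum>t\<in>block N l. stage_payoff q g \<pi> (markov S) \<tau> t)"
            by (intro sum_mono stage_payoff_markov_ge)
          finally show "(v - \<epsilon> / 2) * real N \<le> (\<Sum>t\<in>block N l. stage_payoff q g \<pi> (markov S) \<tau> t)" .
        qed
        then show ?thesis using NT by simp
      qed
      have hi: "gamma q g \<theta> \<pi> \<sigma> (open_loop T) \<le> v + \<epsilon>" for \<sigma>
      proof -
        have "gamma q g \<theta> \<pi> \<sigma> (open_loop T) \<le> (v + 2 * (\<epsilon> / 8)) + real N * total_variation \<theta>"
          by (rule gamma_le_of_blocks[OF \<theta> N])
            (simp only: stage_payoff_open_loop T[OF is_flow_play_flow])
        then show ?thesis using NT \<epsilon> by simp
      qed
      show ?thesis using val_theta_between[OF \<theta> lo hi] lo hi by (simp add: abs_le_iff)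
    qed
    then show "\<exists>\<alpha>>0. \<exists>\<sigma>s \<tau>s. \<forall>\<theta>. is_evaluation \<theta> \<and> total_variation \<theta> \<le> \<alpha> \<longrightarrow>
       \<bar>val_theta q g \<theta> \<pi> - v\<bar> \<le> \<epsilon>
     \<and> (\<forall>\<tau>. gamma q g \<theta> \<pi> \<sigma>s \<tau> \<ge> v - \<epsilon>)
     \<and> (\<forall>\<sigma>. gamma q g \<theta> \<pi> \<sigma> \<tau>s \<le> v + \<epsilon>)"
      using \<alpha> by blast
  qed
qed

end

theorem theorem7:
  fixes q :: "'k::finite \<Rightarrow> 'i::finite \<Rightarrow> 'j::finite \<Rightarrow> ('k \<times> 'c::finite \<times> 'd::finite) pmf"
    and g :: "'k \<Rightarrow> 'i \<Rightarrow> 'j \<Rightarrow> real"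
    and kt :: "'c \<Rightarrow> 'k" and dt :: "'c \<Rightarrow> 'd"
    and \<pi> :: "('k \<times> 'c \<times> 'd) pmf"
  assumes g_range: "\<And>k i j. 0 \<le> g k i j \<and> g k i j \<le> 1"
    and assm1: "\<And>k i j. measure_pmf.prob (q k i j) {(k', c, d). kt c = k' \<and> dt c = d} = 1"
    and assm2: "\<And>k i j j'. map_pmf (\<lambda>(k', c, d). (k', d)) (q k i j)
                          = map_pmf (\<lambda>(k', c, d). (k', d)) (q k i j')"
    and init: "measure_pmf.prob \<pi> {(k, c, d). kt c = k \<and> dt c = d} = 1"
  shows "\<exists>v. \<forall>\<epsilon>>0. \<exists>\<alpha>>0. \<exists>\<sigma>s \<tau>s. \<forall>\<theta>.
           is_evaluation \<theta> \<and> total_variation \<theta> \<le> \<alpha> \<longrightarrow>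
             \<bar>val_theta q g \<theta> \<pi> - v\<bar> \<le> \<epsilon>
           \<and> (\<forall>\<tau>. gamma q g \<theta> \<pi> \<sigma>s \<tau> \<ge> v - \<epsilon>)
           \<and> (\<forall>\<sigma>. gamma q g \<theta> \<pi> \<sigma> \<tau>s \<le> v + \<epsilon>)"
proof -
  have supp: "kt c = k \<and> dt c = d"
    if "measure_pmf.prob p {(k, c, d). kt c = k \<and> dt c = d} = 1" "(k, c, d) \<in> set_pmf p"
    for p :: "('k \<times> 'c \<times> 'd) pmf" and k c d
    using that measure_pmf.prob_eq_1[of "{(k, c, d). kt c = k \<and> dt c = d}" p]
    by (auto simp: AE_measure_pmf_iff)
  \<comment> \<open>Any action of player 2 may be inserted to define \<open>Q\<close>, since the
    marginal is the same for all.\<close>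
  interpret informed_controller "\<lambda>k i. map_pmf (\<lambda>(k', c, d). (k', d)) (q k i undefined)" g q kt dt \<pi>
  proof
    show "map_pmf (\<lambda>(k', c, d). (k', d)) (q k i j) = map_pmf (\<lambda>(k', c, d). (k', d)) (q k i undefined)" for k i j
      by (rule assm2)
  qed (fact g_range supp[OF assm1] supp[OF init])+
  show ?thesis by (rule general_uniform_value)
qed

end
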